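(* (Quarter-temperature contribution for critical Kerr-AdS black holes.) For $\chi>0$, $j>0$ let $$\mathcal R(\chi,j)=\chi^3+2\chi^2+\chi+4j^2+\frac{4j^2}{\chi},\qquad m=\tfrac12\sqrt{\mathcal R},\qquad \sigma=\pi\chi,$$ and regard $m$ as a function of $(\sigma,j)$. Let $\mathcal I_K(\sigma;\tau,j)=m(\sigma,j)/\tau-\sigma$. 1. The critical conditions $m_{\sigma\sigma}=m_{\sigma\sigma\sigma}=0$ (at fixed $j$) hold at $(\chi_c,j_c)$ with $$j_c=\frac{\chi_c^2}{2},\qquad 8\chi_c^3+10\chi_c^2+2\chi_c-1=0,$$ where the cubic has a unique positive root $\chi_c$. The critical entropy and temperature are $$\sigma_c=\pi\chi_c,\qquad \tau_c=m_\sigma(\sigma_c,j_c)=\frac{B_c}{4\pi\sqrt{\mathcal R(\chi_c,j_c)}},\qquad B_c=2\chi_c^2+4\chi_c+1 .$$ 2. At $(\tau_c,j_c)$ the first three $\sigma$-derivatives of $\mathcal I_K$ vanish at $\sigma_c$, and $$\widehat a_{4,K}:=\frac{m_{\sigma\sigma\sigma\sigma}(\sigma_c,j_c)}{24\tau_c}=\frac{1}{\pi^3\chi_cB_c}>0 .$$ 3. At $j=j_c$ there is a unique positive $\chi_e$ at which $m_\sigma=0$, equivalently $3\chi_e^4+4\chi_e^3+\chi_e^2-\chi_c^4=0$, and $\chi_e<\chi_c$. 4. With the energy measure $m_\sigma\,d\sigma$ on $\sigma>\pi\chi_e$, whose density at $\sigma_c$ is $\tau_c>0$, the normalized ensemble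 average $\bar F$ of the generalized free energy at $(\tau_c,j_c)$ satisfies, as $g\to0^+$, $$\frac{\bar F-F_{K,c}}{T_c}=\frac14+\mathcal O(g^{1/2}).$$
   Context: This is the four-dimensional Kerr-AdS canonical reduced ensemble at fixed angular momentum $J$ and AdS radius $L$, with entropy $S$, mass $M$ and temperature $T_E$, in dimensionless variables $g=G_N/L^2$, $\sigma=gS$, $j=gJ$, $m=G_NM/L$, $\tau=LT_E$. Subscripts $\sigma$ denote partial derivatives at fixed $j$. The dimensionless Hawking temperature is $\tau_H=m_\sigma$. The generalized free energy is $F_{\mathrm{gen}}=M-T_ES$ and the reduced action is $I_E=F_{\mathrm{gen}}/T_E=\mathcal I_K/g$. At $T_E=T_c=\tau_c/L$ and $j=j_c$, $F_{K,c}=T_c\,\mathcal I_K(\sigma_c;\tau_c,j_c)/g$ is the classical critical free energy, and $$\bar F=\frac{\int_{\pi\chi_e}^\infty F_{\mathrm{gen}}\,m_\sigma\,e^{-I_E}\,d\sigma}{\int_{\pi\chi_e}^\infty m_\sigma\,e^{-I_E}\,d\sigma}.$$ *)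

theory Defs
  imports "HOL-Analysis.Analysis" "HOL-Library.Landau_Symbols"
begin

text \<open>Horizon variable \<open>\<chi>\<close> is written \<open>x\<close>, since \<open>\<chi>\<close> is the vector binder of \<open>HOL-Analysis\<close>.\<close>

definition R_K :: "real \<Rightarrow> real \<Rightarrow> real" where
  "R_K x j = x^3 + 2*x^2 + x + 4*j^2 + 4*j^2/x"

definition m_K :: "real \<Rightarrow> real \<Rightarrow> real" where
  "m_K \<sigma> j = (1/2) * sqrt (R_K (\<sigma>/pi) j)"

text \<open>The \<open>n\<close>-th partial derivative of the mass in \<open>\<sigma>\<close> at fixed \<open>j\<close>. It is only used at \<open>\<sigma> > 0\<close>,
  where \<open>m_K\<close> is smooth because \<open>R_K\<close> is positive there.\<close>

definition dm_K :: "nat \<Rightarrow> real \<Rightarrow> real \<Rightarrow> real" where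
  "dm_K n \<sigma> j = (deriv ^^ n) (\<lambda>s. m_K s j) \<sigma>"

definition I_K :: "real \<Rightarrow> real \<Rightarrow> real \<Rightarrow> real" where
  "I_K \<sigma> \<tau> j = m_K \<sigma> j / \<tau> - \<sigma>"

definition chi_c :: real where
  "chi_c = (THE x. x > 0 \<and> 8*x^3 + 10*x^2 + 2*x - 1 = 0)"

definition j_c :: real where
  "j_c = chi_c^2 / 2"

definition sigma_c :: real where
  "sigma_c = pi * chi_c"

definition tau_c :: real where
  "tau_c = dm_K 1 sigma_c j_c"

definition B_c :: real where
  "B_c = 2*chi_c^2 + 4*chi_c + 1"

definition a4_K :: real where
  "a4_K = dm_K 4 sigma_c j_c / (24 * tau_c)"

definition chi_e :: real where
  "chi_e = (THE x. x > 0 \<and> dm_K 1 (pi*x) j_c = 0)"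

text \<open>Dimensionful quantities, as functions of \<open>g = G_N/L^2\<close>, the AdS radius \<open>L\<close> and the dimensionless
  variables; they invert \<open>\<sigma> = g S\<close>, \<open>m = G_N M/L\<close> and \<open>\<tau> = L T_E\<close>.\<close>

definition G_N :: "real \<Rightarrow> real \<Rightarrow> real" where
  "G_N g L = g * L^2"

definition S_phys :: "real \<Rightarrow> real \<Rightarrow> real" where
  "S_phys g \<sigma> = \<sigma> / g"

definition M_phys :: "real \<Rightarrow> real \<Rightarrow> real \<Rightarrow> real \<Rightarrow> real" where
  "M_phys g L \<sigma> j = L * m_K \<sigma> j / G_N g L"

definition T_phys :: "real \<Rightarrow> real \<Rightarrow> real" where
  "T_phys L \<tau> = \<tau> / L"

definition F_gen :: "real \<Rightarrow> real \<Rightarrow> real \<Rightarrow> real \<Rightarrow> real \<Rightarrow> real" where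
  "F_gen g L \<sigma> \<tau> j = M_phys g L \<sigma> j - T_phys L \<tau> * S_phys g \<sigma>"

definition I_E :: "real \<Rightarrow> real \<Rightarrow> real \<Rightarrow> real \<Rightarrow> real \<Rightarrow> real" where
  "I_E g L \<sigma> \<tau> j = F_gen g L \<sigma> \<tau> j / T_phys L \<tau>"

lemma I_E_eq:
  assumes "g > 0" "L > 0" "\<tau> \<noteq> 0"
  shows "I_E g L \<sigma> \<tau> j = I_K \<sigma> \<tau> j / g"
  using assms
  by (simp add: I_E_def F_gen_def M_phys_def S_phys_def T_phys_def G_N_def I_K_def
      field_simps power2_eq_square)

definition T_c :: "real \<Rightarrow> real" where
  "T_c L = T_phys L tau_c"

definition F_Kc :: "real \<Rightarrow> real \<Rightarrow> real" where
  "F_Kc g L = T_c L * I_K sigma_c tau_c j_c / g"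

text \<open>Unnormalized weight of the critical ensemble with respect to \<open>d\<sigma>\<close>: energy measure times
  Boltzmann factor.\<close>

definition weight :: "real \<Rightarrow> real \<Rightarrow> real \<Rightarrow> real" where
  "weight g L \<sigma> = dm_K 1 \<sigma> j_c * exp (- I_E g L \<sigma> tau_c j_c)"

definition F_bar :: "real \<Rightarrow> real \<Rightarrow> real" where
  "F_bar g L =
     (LINT \<sigma>:{pi*chi_e<..}|lborel. F_gen g L \<sigma> tau_c j_c * weight g L \<sigma>) /
     (LINT \<sigma>:{pi*chi_e<..}|lborel. weight g L \<sigma>)"

end

theory Submission
  imports Defs
begin

text \<open>At the critical point the reduced action, measured from its critical value, is exactly
  \<open>f s = s^4 * h s\<close> with \<open>s = \<sigma> - sigma_c\<close> and \<open>h\<close> smooth and positive, while the energy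
  measure is \<open>tau_c * (1 + f' s) ds\<close>. Its \<open>f'\<close> part integrates in closed form and contributes
  only \<open>O(g)\<close>. For the flat part, integrating \<open>s * exp (- f s / g)\<close> by parts shows that the mean
  of \<open>f / g\<close> is \<open>1/4\<close> up to the mean of \<open>s^5 * h' s / (4 g)\<close>, whose leading term is odd; after
  reflection it is \<open>O(g powr (3/4))\<close>, against a partition function of order \<open>g powr (1/4)\<close>.\<close>

section \<open>Laplace asymptotics at a quartic minimum\<close>

text \<open>The integrals run over an unbounded half-line, so a textbook Laplace argument would need
  a concentration estimate and a Taylor expansion with remainder. Both are avoided. The mass is
  convex in \<sigma> at \<open>j_c\<close>, so \<open>f'\<close> is monotone; beyond the window it
  stays above \<open>f' d > 0\<close>, and the flat part of the measure is dominated there by the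
  part with a closed primitive. The tail is thus only shown to be O(g), which suffices because the
  allowed error is of order \<open>g powr (3/4)\<close>. The half-width
  \<open>d = sigma_c - pi * chi_e\<close> reaches exactly to the left end of the domain: only a
  right tail remains, and the window is symmetric, as the reflection requires. The value 1/4 is the
  reciprocal of the degree of homogeneity of the quartic, read off from
  \<open>s * f' = 4 * f\<close> to leading order. Gamma values never occur, and moments of
  \<open>exp (- c * u ^ 4)\<close> are needed only as upper bounds. Writing \<open>g = q ^ 4\<close>
  turns all fractional powers into natural ones.\<close>

lemma exp_neg_le_inverse: "exp (- y) \<le> 1 / y" if "0 < y" for y :: real
proof -
  have "y \<le> exp y" using exp_ge_add_one_self[of y] by linarith
  then show ?thesis using that by (simp add: exp_minus field_simps)
qed

lemma one_plus_times_exp_neg_le: "(1 + y) * exp (- y) \<le> (1::real)"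
  using exp_ge_add_one_self[of y] by (simp add: exp_minus field_simps)

text \<open>The majorant \<open>1 / (1 + u\<^sup>2)\<close> is chosen because its primitive is
  \<open>arctan\<close>. The limit \<open>n \<le> 10\<close> comes from
  \<open>u ^ 10 * u\<^sup>2 = (u ^ 4) ^ 3\<close>, a cube that the exponential absorbs; the powers
  needed later are 6 and 10.\<close>

lemma power_times_exp_neg_quartic_le:
  fixes c u :: real
  assumes "0 < c" "0 \<le> u" "n \<le> 10"
  shows "u ^ n * exp (- (c * u ^ 4)) \<le> (2 + 54 / c ^ 3) / (1 + u\<^sup>2)"
proof -
  have "u ^ n * (1 + u\<^sup>2) \<le> 2 + 2 * u ^ 12"
  proof (cases "u \<le> 1")
    case True
    have "u ^ n * (1 + u\<^sup>2) \<le> 1 * 2"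
      using True assms power_le_one[of u n] power_le_one[of u 2] by (intro mult_mono) auto
    also have "\<dots> \<le> 2 + 2 * u ^ 12" using assms by simp
    finally show ?thesis .
  next
    case False
    then have u: "1 \<le> u" by simp
    have "u ^ n * (1 + u\<^sup>2) \<le> u ^ 10 * (2 * u\<^sup>2)"
      using u assms one_le_power[of u 2] by (intro mult_mono power_increasing) auto
    also have "\<dots> = 2 * u ^ 12" by (simp flip: power_add)
    finally show ?thesis by simp
  qed
  \<comment> \<open>With \<open>y = c * u ^ 4\<close>, the inequality
    \<open>(1 + y / 3) ^ 3 \<le> exp y\<close> gives \<open>y ^ 3 \<le> 27 * exp y\<close>; doubling
    yields 54.\<close>
  also have "2 * u ^ 12 \<le> 54 / c ^ 3 * exp (c * u ^ 4)"
  proof -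
    have "0 \<le> c * u ^ 4" using assms by simp
    then have "(c * u ^ 4 / 3) ^ 3 \<le> (1 + c * u ^ 4 / real 3) ^ 3"
      by (intro power_mono) auto
    also have "\<dots> \<le> exp (c * u ^ 4)"
      using \<open>0 \<le> c * u ^ 4\<close> by (intro exp_ge_one_plus_x_over_n_power_n) auto
    finally have "c ^ 3 * u ^ 12 / 27 \<le> exp (c * u ^ 4)"
      by (simp add: power_mult_distrib power_divide flip: power_mult)
    then show ?thesis using assms by (simp add: field_simps)
  qed
  finally have "u ^ n * (1 + u\<^sup>2) \<le> 2 + 54 / c ^ 3 * exp (c * u ^ 4)" by simp
  also have "\<dots> \<le> (2 + 54 / c ^ 3) * exp (c * u ^ 4)"
    using assms by (simp add: algebra_simps)
  finally have "u ^ n * (1 + u\<^sup>2) \<le> (2 + 54 / c ^ 3) * exp (c * u ^ 4)" .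
  moreover have "0 < 1 + u\<^sup>2" by (simp add: add_pos_nonneg)
  ultimately show ?thesis by (simp add: exp_minus divide_simps)
qed

text \<open>This is the substitution \<open>s = q * u\<close>, carried out through the primitive
  \<open>arctan (s / q)\<close>. The extra factor \<open>q\<close> in \<open>q ^ Suc n\<close> is
  the Jacobian, and the bound does not depend on \<open>d\<close>.\<close>

lemma integral_quartic_moment_le:
  fixes c d q :: real
  assumes "0 < c" "0 < d" "0 < q" "n \<le> 10"
  shows "integral {0..d} (\<lambda>s. s ^ n * exp (- (c * s ^ 4 / q ^ 4))) \<le> (2 + 54 / c ^ 3) * pi * q ^ Suc n"
proof -
  let ?K = "2 + 54 / c ^ 3"
  have K: "0 < ?K" using assms by (simp add: add_pos_pos)
  have "((\<lambda>s. ?K * q ^ n / (1 + (s / q)\<^sup>2)) has_integral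
      ?K * q ^ Suc n * arctan (d / q) - ?K * q ^ Suc n * arctan (0 / q)) {0..d}"
    using assms
    by (intro fundamental_theorem_of_calculus)
       (auto intro!: derivative_eq_intros simp: divide_inverse mult_ac
        simp flip: has_real_derivative_iff_has_vector_derivative)
  then have I: "((\<lambda>s. ?K * q ^ n / (1 + (s / q)\<^sup>2)) has_integral ?K * q ^ Suc n * arctan (d / q)) {0..d}"
    by simp
  have "integral {0..d} (\<lambda>s. s ^ n * exp (- (c * s ^ 4 / q ^ 4)))
      \<le> integral {0..d} (\<lambda>s. ?K * q ^ n / (1 + (s / q)\<^sup>2))"
  proof (rule integral_le)
    show "(\<lambda>s. s ^ n * exp (- (c * s ^ 4 / q ^ 4))) integrable_on {0..d}"
      using assms by (intro integrable_continuous_interval continuous_intros) auto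
    show "(\<lambda>s. ?K * q ^ n / (1 + (s / q)\<^sup>2)) integrable_on {0..d}"
      using I by (rule has_integral_integrable)
    show "s ^ n * exp (- (c * s ^ 4 / q ^ 4)) \<le> ?K * q ^ n / (1 + (s / q)\<^sup>2)" if "s \<in> {0..d}" for s
    proof -
      have "q ^ n * ((s / q) ^ n * exp (- (c * (s / q) ^ 4))) \<le> q ^ n * (?K / (1 + (s / q)\<^sup>2))"
        using assms that by (intro mult_left_mono power_times_exp_neg_quartic_le) auto
      then show ?thesis using assms by (simp add: power_divide mult.commute)
    qed
  qed
  also have "\<dots> = ?K * q ^ Suc n * arctan (d / q)" using I by (rule integral_unique)
  also have "\<dots> \<le> ?K * q ^ Suc n * pi"
    using K assms order.trans[OF less_imp_le[OF arctan_ubound[of "d / q"]], of pi]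
    by (intro mult_left_mono) auto
  finally show ?thesis by (simp add: mult_ac)
qed

text \<open>\<open>- e\<close> bounds the region where everything is smooth, while
  \<open>- d\<close> is the left end of integration. \<open>f'_ge\<close> together with monotonicity
  makes the density \<open>1 + f'\<close> nonnegative on the whole domain. Two derivatives of
  \<open>h\<close> are required because the reflection argument compares \<open>h'\<close> at
  \<open>s\<close> and \<open>- s\<close>.\<close>

locale quartic_minimum =
  fixes f f' h h' h'' :: "real \<Rightarrow> real" and d e :: real
  assumes d_pos: "0 < d" and d_less: "d < e"
    and f_deriv: "\<And>s. - e < s \<Longrightarrow> (f has_real_derivative f' s) (at s)"
    and f'_mono: "\<And>s t. - e < s \<Longrightarrow> s \<le> t \<Longrightarrow> f' s \<le> f' t"
    and f'_ge: "- 1 \<le> f' (- d)"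
    and f_eq: "\<And>s. - e < s \<Longrightarrow> f s = s ^ 4 * h s"
    and h_pos: "\<And>s. - e < s \<Longrightarrow> 0 < h s"
    and h_deriv: "\<And>s. - e < s \<Longrightarrow> (h has_real_derivative h' s) (at s)"
    and h'_deriv: "\<And>s. - e < s \<Longrightarrow> (h' has_real_derivative h'' s) (at s)"
    and h''_cont: "\<And>s. - e < s \<Longrightarrow> isCont h'' s"
begin

section \<open>Consequences of convexity and of the quartic factorization\<close>

lemma f'_eq: "f' s = 4 * s ^ 3 * h s + s ^ 4 * h' s" if "- e < s"
proof -
  have "((\<lambda>s. s ^ 4 * h s) has_real_derivative 4 * s ^ 3 * h s + s ^ 4 * h' s) (at s)"
    using h_deriv[OF that] by (auto intro!: derivative_eq_intros)
  moreover have "eventually (\<lambda>s. f s = s ^ 4 * h s) (nhds s)"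
    using that eventually_nhds_in_open[of "{- e<..}" s] by (auto elim!: eventually_mono simp: f_eq)
  ultimately have "(f has_real_derivative 4 * s ^ 3 * h s + s ^ 4 * h' s) (at s)"
    by (subst DERIV_cong_ev) auto
  then show ?thesis using f_deriv[OF that] DERIV_unique by blast
qed

lemma isCont_f: "- e < s \<Longrightarrow> isCont f s"
  and isCont_h: "- e < s \<Longrightarrow> isCont h s"
  and isCont_h': "- e < s \<Longrightarrow> isCont h' s"
  using f_deriv h_deriv h'_deriv DERIV_isCont by blast+

lemma isCont_f': "isCont f' s" if "- e < s"
proof -
  have "eventually (\<lambda>s. f' s = 4 * s ^ 3 * h s + s ^ 4 * h' s) (nhds s)"
    using that eventually_nhds_in_open[of "{- e<..}" s] by (auto elim!: eventually_mono simp: f'_eq)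
  then have "isCont f' s \<longleftrightarrow> isCont (\<lambda>s. 4 * s ^ 3 * h s + s ^ 4 * h' s) s"
    by (rule isCont_cong)
  then show ?thesis using isCont_h isCont_h' that by simp
qed

lemma continuous_on_cont:
  assumes "\<And>s. - e < s \<Longrightarrow> isCont p s" "S \<subseteq> {- e<..}"
  shows "continuous_on S p"
  using assms by (intro continuous_at_imp_continuous_on) auto

lemma f_nonneg: "- e < s \<Longrightarrow> 0 \<le> f s"
  using h_pos[of s] by (simp add: f_eq)

lemma f'_nonneg: "0 \<le> f' s" if "0 \<le> s"
  using f'_mono[of 0 s] f'_eq[of 0] d_pos d_less that by simp

lemma f_d_pos: "0 < f d" "0 < f (- d)"
  using d_pos d_less h_pos by (auto simp: f_eq)

lemma f_MVT:
  assumes "- e < a" "a < b"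
  obtains z where "a < z" "z < b" "f b - f a = (b - a) * f' z"
proof -
  have "\<exists>z>a. z < b \<and> f b - f a = (b - a) * f' z"
    using assms by (intro MVT2 f_deriv) auto
  then show thesis using that by blast
qed

text \<open>Since \<open>f 0 = 0 < f d\<close>, the slope is positive somewhere between, and
  monotonicity carries this to \<open>d\<close>. This positive slope controls the whole
  tail.\<close>

lemma f'_d_pos: "0 < f' d"
proof -
  obtain z where z: "0 < z" "z < d" "f d - f 0 = (d - 0) * f' z"
    by (rule f_MVT[of 0 d]) (use d_pos d_less in auto)
  have "0 < d * f' z" using z f_d_pos f_eq[of 0] d_pos d_less by simp
  then have "0 < f' z" using d_pos by (simp add: zero_less_mult_iff)
  also have "\<dots> \<le> f' d" using z d_pos d_less by (intro f'_mono) auto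
  finally show ?thesis .
qed

lemma f_ge_linear: "f d + f' d * (s - d) \<le> f s" if "d \<le> s"
proof (cases "s = d")
  case False
  then have "- e < d" "d < s" using that d_pos d_less by auto
  then obtain z where z: "d < z" "z < s" "f s - f d = (s - d) * f' z"
    by (rule f_MVT)
  moreover have "(s - d) * f' d \<le> (s - d) * f' z"
    using z that d_pos d_less by (intro mult_left_mono f'_mono) auto
  ultimately show ?thesis by (simp add: algebra_simps)
qed simp

lemma filterlim_f_at_top: "filterlim f at_top at_top"
proof (rule filterlim_at_top_mono)
  have "filterlim (\<lambda>s. f' d * s) at_top at_top"
    using f'_d_pos by (intro filterlim_tendsto_pos_mult_at_top[OF tendsto_const]) (auto simp: filterlim_ident)
  then show "filterlim (\<lambda>s. (f d - f' d * d) + f' d * s) at_top at_top"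
    by (intro filterlim_tendsto_add_at_top[OF tendsto_const])
  show "eventually (\<lambda>s. (f d - f' d * d) + f' d * s \<le> f s) at_top"
  proof (rule eventually_mono[OF eventually_ge_at_top[of d]])
    fix s assume "d \<le> s"
    from f_ge_linear[OF this] show "(f d - f' d * d) + f' d * s \<le> f s"
      by (simp add: algebra_simps)
  qed
qed

section \<open>The Boltzmann factor and its primitives\<close>

definition boltzmann :: "real \<Rightarrow> real \<Rightarrow> real" where
  "boltzmann g s = exp (- (f s / g))"

lemma boltzmann_pos: "0 < boltzmann g s"
  by (simp add: boltzmann_def)

lemma isCont_boltzmann: "isCont (boltzmann g) s" if "- e < s" "0 < g"
  unfolding boltzmann_def using that isCont_f by (intro continuous_intros) auto

lemma DERIV_boltzmann:
  "(boltzmann g has_real_derivative - (f' s / g) * boltzmann g s) (at s)" if "- e < s" "0 < g"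
  unfolding boltzmann_def using that by (auto intro!: derivative_eq_intros f_deriv)

text \<open>The first two integrate the \<open>f'\<close> part of the measure in the denominator and
  in the numerator of the mean; the third is the integration by parts behind the value 1/4.\<close>

lemma DERIV_boltzmann_primitives:
  assumes "- e < s" "0 < g"
  shows "((\<lambda>s. - g * boltzmann g s) has_real_derivative f' s * boltzmann g s) (at s)"
    and "((\<lambda>s. - (g + f s) * boltzmann g s) has_real_derivative f s / g * (f' s * boltzmann g s)) (at s)"
    and "((\<lambda>s. s * boltzmann g s) has_real_derivative (1 - s * f' s / g) * boltzmann g s) (at s)"
  using assms
  by (auto intro!: derivative_eq_intros DERIV_boltzmann f_deriv simp: field_simps)

lemma boltzmann_bounds:
  assumes "- e < s" "0 < g"
  shows "g * boltzmann g s \<le> g" "(g + f s) * boltzmann g s \<le> g"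
    and "0 < f s \<Longrightarrow> boltzmann g s \<le> g / f s"
proof -
  have "0 \<le> f s / g" using f_nonneg assms by simp
  then show "g * boltzmann g s \<le> g" using assms by (simp add: boltzmann_def mult_left_le)
  have "g * ((1 + f s / g) * boltzmann g s) \<le> g * 1"
    unfolding boltzmann_def using assms by (intro mult_left_mono one_plus_times_exp_neg_le) auto
  moreover have "g * (1 + f s / g) = g + f s" using assms by (simp add: distrib_left)
  ultimately show "(g + f s) * boltzmann g s \<le> g" by (simp flip: mult.assoc)
  show "boltzmann g s \<le> g / f s" if "0 < f s"
    using exp_neg_le_inverse[of "f s / g"] that assms by (simp add: boltzmann_def)
qed

definition W :: "real \<Rightarrow> real \<Rightarrow> real" where
  "W g s = (1 + f' s) * boltzmann g s"

lemma isCont_W: "isCont (W g) s" "isCont (\<lambda>s. f s / g * W g s) s" if "- e < s" "0 < g"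
  unfolding W_def using that isCont_f isCont_f' isCont_boltzmann
  by (auto intro!: continuous_intros)

lemma W_nonneg: "0 \<le> W g s" if "- d \<le> s"
  using f'_mono[of "- d" s] f'_ge that d_less boltzmann_pos[of g s] by (auto simp: W_def)

section \<open>Integrals over the right tail\<close>

lemma tail_FTC:
  fixes P p :: "real \<Rightarrow> real"
  assumes "\<And>s. d \<le> s \<Longrightarrow> (P has_real_derivative p s) (at s)"
    and "\<And>s. d \<le> s \<Longrightarrow> isCont p s"
    and "\<And>s. d \<le> s \<Longrightarrow> 0 \<le> p s"
    and "(P \<longlongrightarrow> 0) at_top"
  shows "set_integrable lborel {d<..} p" "(LINT s:{d<..}|lborel. p s) = - P d"
proof -
  have A: "((P \<circ> real_of_ereal) \<longlongrightarrow> P d) (at_right (ereal d))"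
    using DERIV_isCont[OF assms(1)[of d]]
    by (intro ereal_tendsto_simps(2)[THEN iffD2]) (auto simp: isCont_def intro: filterlim_mono at_le)
  have B: "((P \<circ> real_of_ereal) \<longlongrightarrow> 0) (at_left \<infinity>)"
    using assms(4) by (simp add: ereal_tendsto_simps)
  \<comment> \<open>For a nonnegative integrand the limit of the primitive yields integrability
    together with the value, so no dominating function is needed.\<close>
  note FTC = interval_integral_FTC_nonneg[of "ereal d" \<infinity> P p "P d" 0, OF _ _ _ _ A B]
  have "einterval (ereal d) \<infinity> = {d<..}" by (auto simp: einterval_def)
  then show "set_integrable lborel {d<..} p"
    using FTC(1) assms(1-3) by auto
  show "(LINT s:{d<..}|lborel. p s) = - P d"
    using FTC(2) assms(1-3) \<open>einterval (ereal d) \<infinity> = {d<..}\<close>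
    by (auto simp: interval_lebesgue_integral_def)
qed

text \<open>Both expressions depend on \<open>s\<close> only through \<open>y = f s / g\<close>,
  being \<open>- g * exp (- y)\<close> and \<open>- g * (1 + y) * exp (- y)\<close>, and
  \<open>y\<close> tends to infinity with \<open>f\<close>.\<close>

lemma boltzmann_tendsto_0:
  assumes "0 < g"
  shows "((\<lambda>s. - g * boltzmann g s) \<longlongrightarrow> 0) at_top"
    and "((\<lambda>s. - (g + f s) * boltzmann g s) \<longlongrightarrow> 0) at_top"
proof -
  have lim: "filterlim (\<lambda>s. f s / g) at_top at_top"
    using filterlim_tendsto_pos_mult_at_top[OF tendsto_const[of "1 / g"] _ filterlim_f_at_top] assms by simp
  have e: "((\<lambda>y::real. exp (- y)) \<longlongrightarrow> 0) at_top" "((\<lambda>y::real. y * exp (- y)) \<longlongrightarrow> 0) at_top"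
    using tendsto_power_div_exp_0[of 0] tendsto_power_div_exp_0[of 1]
    by (simp_all add: exp_minus divide_inverse)
  have "((\<lambda>y. - g * exp (- y)) \<longlongrightarrow> 0) at_top" "((\<lambda>y. - g * (1 + y) * exp (- y)) \<longlongrightarrow> 0) at_top"
    using tendsto_mult[OF tendsto_const[of "- g"] e(1)]
      tendsto_mult[OF tendsto_const[of "- g"] tendsto_add[OF e]]
    by (simp_all add: algebra_simps)
  from this[THEN filterlim_compose, OF lim]
  show "((\<lambda>s. - g * boltzmann g s) \<longlongrightarrow> 0) at_top"
    "((\<lambda>s. - (g + f s) * boltzmann g s) \<longlongrightarrow> 0) at_top"
    using assms by (simp_all add: boltzmann_def field_simps diff_divide_distrib)
qed

lemma tail_le:
  fixes p k :: "real \<Rightarrow> real"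
  assumes k: "set_integrable lborel {d<..} k" and b: "(LINT s:{d<..}|lborel. k s) \<le> g"
    and p: "\<And>s. - e < s \<Longrightarrow> isCont p s" "\<And>s. d \<le> s \<Longrightarrow> 0 \<le> p s"
      "\<And>s. d \<le> s \<Longrightarrow> p s \<le> K * k s" and "0 \<le> K"
  shows "set_integrable lborel {d<..} p"
    and "(LINT s:{d<..}|lborel. p s) \<in> {0..K * g}"
proof -
  have kK: "set_integrable lborel {d<..} (\<lambda>s. K * k s)"
    using k by (rule set_integrable_mult_right)
  have "continuous_on {d<..} p" using p(1) d_pos d_less by (intro continuous_on_cont) auto
  then have "set_borel_measurable lborel {d<..} p"
    unfolding set_borel_measurable_def
    using borel_measurable_continuous_on_indicator[of "{d<..}" p] by simp
  then show I: "set_integrable lborel {d<..} p"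
  proof (rule set_integrable_bound[OF kK])
    show "AE s in lborel. s \<in> {d<..} \<longrightarrow> norm (p s) \<le> norm (K * k s)"
      using p(2,3) by (intro AE_I2) (force intro: order_trans[OF _ abs_ge_self])
  qed
  have "(LINT s:{d<..}|lborel. p s) \<le> (LINT s:{d<..}|lborel. K * k s)"
    using I kK p(3) by (intro set_integral_mono) auto
  also have "\<dots> \<le> K * g" using b \<open>0 \<le> K\<close> by (simp add: mult_left_mono)
  finally show "(LINT s:{d<..}|lborel. p s) \<in> {0..K * g}"
    using p(2) by (auto simp: set_lebesgue_integral_def intro!: Bochner_Integration.integral_nonneg split: split_indicator)
qed

text \<open>For \<open>d \<le> s\<close> monotonicity gives \<open>1 \<le> f' s / f' d\<close>,
  hence \<open>1 + f' s \<le> (1 + 1 / f' d) * f' s\<close>. What remains has a closed primitive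
  whose boundary value at \<open>d\<close> is at most \<open>g\<close>.\<close>

lemma tail_W:
  assumes "0 < g"
  shows "set_integrable lborel {d<..} (W g)"
    and "(LINT s:{d<..}|lborel. W g s) \<in> {0..(1 + 1 / f' d) * g}"
    and "set_integrable lborel {d<..} (\<lambda>s. f s / g * W g s)"
    and "(LINT s:{d<..}|lborel. f s / g * W g s) \<in> {0..(1 + 1 / f' d) * g}"
proof -
  let ?K = "1 + 1 / f' d"
  have de: "- e < s" "0 \<le> s" if "d \<le> s" for s using that d_pos d_less by auto
  have f: "0 \<le> f s" "0 \<le> f' s" if "d \<le> s" for s
    using f_nonneg f'_nonneg de[OF that] by auto
  have le: "1 + f' s \<le> ?K * f' s" if "d \<le> s" for s
    using f'_mono[of d s] f'_d_pos that de[of d] by (simp add: field_simps)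
  have W_le: "W g s \<le> ?K * (f' s * boltzmann g s)" if "d \<le> s" for s
    using mult_right_mono[OF le[OF that], of "boltzmann g s"] boltzmann_pos[of g s]
    by (simp add: W_def mult.assoc)
  have cont: "isCont (\<lambda>s. f' s * boltzmann g s) s" "isCont (\<lambda>s. f s / g * (f' s * boltzmann g s)) s"
    if "d \<le> s" for s
    using de[OF that] assms isCont_f isCont_f' isCont_boltzmann
    by (auto intro!: continuous_intros)
  note nn = boltzmann_pos[THEN less_imp_le] f assms[THEN less_imp_le]
  have nn1: "0 \<le> f' s * boltzmann g s" "0 \<le> f s / g * (f' s * boltzmann g s)" if "d \<le> s" for s
    using nn that by auto
  have T1: "set_integrable lborel {d<..} (\<lambda>s. f' s * boltzmann g s)"
    "(LINT s:{d<..}|lborel. f' s * boltzmann g s) = - (- g * boltzmann g d)"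
    by (rule tail_FTC[OF DERIV_boltzmann_primitives(1)[OF de(1) assms] cont(1) nn1(1)
          boltzmann_tendsto_0(1)[OF assms]]; assumption)+
  have T2: "set_integrable lborel {d<..} (\<lambda>s. f s / g * (f' s * boltzmann g s))"
    "(LINT s:{d<..}|lborel. f s / g * (f' s * boltzmann g s)) = - (- (g + f d) * boltzmann g d)"
    by (rule tail_FTC[OF DERIV_boltzmann_primitives(2)[OF de(1) assms] cont(2) nn1(2)
          boltzmann_tendsto_0(2)[OF assms]]; assumption)+
  have b: "(LINT s:{d<..}|lborel. f' s * boltzmann g s) \<le> g"
    "(LINT s:{d<..}|lborel. f s / g * (f' s * boltzmann g s)) \<le> g"
    unfolding T1(2) T2(2) mult_minus_left minus_minus using boltzmann_bounds(1,2)[OF de(1)[of d] assms] by auto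
  have K: "0 \<le> ?K" using f'_d_pos by simp
  have W0: "0 \<le> W g s" if "d \<le> s" for s using W_nonneg that d_pos by simp
  show "set_integrable lborel {d<..} (W g)"
    "(LINT s:{d<..}|lborel. W g s) \<in> {0..?K * g}"
    using tail_le[OF T1(1) b(1) isCont_W(1)[OF _ assms] W0 W_le K] by auto
  have W_le': "f s / g * W g s \<le> ?K * (f s / g * (f' s * boltzmann g s))" if "d \<le> s" for s
    using mult_left_mono[OF W_le[OF that], of "f s / g"] f[OF that] assms by (simp add: mult_ac)
  have W0': "0 \<le> f s / g * W g s" if "d \<le> s" for s using W0 f that assms by simp
  show "set_integrable lborel {d<..} (\<lambda>s. f s / g * W g s)"
    "(LINT s:{d<..}|lborel. f s / g * W g s) \<in> {0..?K * g}"
    using tail_le[OF T2(1) b(2) isCont_W(2)[OF _ assms] W0' W_le' K] by auto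
qed

section \<open>The symmetric window\<close>

lemma LINT_split:
  fixes p :: "real \<Rightarrow> real"
  assumes "\<And>s. - e < s \<Longrightarrow> isCont p s" and tail: "set_integrable lborel {d<..} p"
  shows "set_integrable lborel {- d<..} p"
    and "(LINT s:{- d<..}|lborel. p s) = integral {- d..d} p + (LINT s:{d<..}|lborel. p s)"
proof -
  have "continuous_on {- d..d} p" using assms(1) d_less by (intro continuous_on_cont) auto
  then have loc: "set_integrable lborel {- d..d} p" by (rule borel_integrable_atLeastAtMost')
  have eq: "{- d..} = {- d..d} \<union> {d<..}" using d_pos by auto
  have I: "set_integrable lborel {- d..} p"
    unfolding eq using loc tail by (intro set_integrable_Un) auto
  then show I': "set_integrable lborel {- d<..} p" by (rule set_integrable_subset) auto
  \<comment> \<open>The ensemble lives on an open half-line, the window is closed; they differ by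
    the null set \<open>{- d}\<close>.\<close>
  have "(LINT s:{- d<..}|lborel. p s) = (LINT s:{- d..}|lborel. p s)"
  proof (rule set_integral_cong_set)
    show "set_borel_measurable lborel {- d..} p" "set_borel_measurable lborel {- d<..} p"
      using I I' by (auto simp: set_integrable_def set_borel_measurable_def)
    show "AE x in lborel. x \<in> {- d..} \<longleftrightarrow> x \<in> {- d<..}"
      using AE_lborel_singleton[of "- d"] by eventually_elim auto
  qed
  also have "\<dots> = (LINT s:{- d..d}|lborel. p s) + (LINT s:{d<..}|lborel. p s)"
    unfolding eq using loc tail by (intro set_integral_Un) auto
  finally show "(LINT s:{- d<..}|lborel. p s) = integral {- d..d} p + (LINT s:{d<..}|lborel. p s)"
    using set_borel_integral_eq_integral(2)[OF loc] by simp
qed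

lemma local_FTC:
  assumes "\<And>s. - e < s \<Longrightarrow> (P has_real_derivative p s) (at s)"
  shows "(p has_integral P d - P (- d)) {- d..d}"
  using assms d_pos d_less
  by (intro fundamental_theorem_of_calculus)
     (auto simp flip: has_real_derivative_iff_has_vector_derivative intro: has_field_derivative_at_within)

lemma integrable_local:
  fixes p :: "real \<Rightarrow> real"
  assumes "\<And>s. - e < s \<Longrightarrow> isCont p s" "- e < a"
  shows "p integrable_on {a..b}"
  using assms by (intro integrable_continuous_interval continuous_on_cont) auto

text \<open>Each quantity is a difference of boundary values at \<open>d\<close> and
  \<open>- d\<close>. In the first two, both boundary values lie between 0 and \<open>g\<close> up
  to a common sign, so their difference is at most \<open>g\<close>. In the third they add up, and
  \<open>exp (- y) \<le> 1 / y\<close> bounds each by a multiple of \<open>g\<close>.\<close>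

lemma local_W:
  assumes "0 < g"
  shows "\<bar>integral {- d..d} (W g) - integral {- d..d} (boltzmann g)\<bar> \<le> g"
    and "\<bar>integral {- d..d} (\<lambda>s. f s / g * W g s)
        - integral {- d..d} (\<lambda>s. f s / g * boltzmann g s)\<bar> \<le> g"
    and "\<bar>integral {- d..d} (\<lambda>s. (1 - s * f' s / g) * boltzmann g s)\<bar> \<le> d * (1 / f d + 1 / f (- d)) * g"
proof -
  have de: "- e < d" "- e < - d" using d_pos d_less by auto
  note D = DERIV_boltzmann_primitives[OF _ assms]
  note b = boltzmann_bounds[OF _ assms]
  have nn: "0 \<le> boltzmann g s" for s using boltzmann_pos[of g s] by simp
  have int: "boltzmann g integrable_on {- d..d}" "(\<lambda>s. f s / g * boltzmann g s) integrable_on {- d..d}"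
    using de assms by (auto intro!: integrable_local isCont_boltzmann continuous_intros isCont_f)
  have "((\<lambda>s. f' s * boltzmann g s + boltzmann g s) has_integral
      (- g * boltzmann g d - - g * boltzmann g (- d)) + integral {- d..d} (boltzmann g)) {- d..d}"
    using int(1) by (intro has_integral_add local_FTC D(1)) (auto simp: has_integral_integral)
  moreover have "(\<lambda>s. f' s * boltzmann g s + boltzmann g s) = W g"
    by (auto simp: W_def algebra_simps)
  ultimately have "integral {- d..d} (W g) =
      (- g * boltzmann g d - - g * boltzmann g (- d)) + integral {- d..d} (boltzmann g)"
    by (auto intro: integral_unique)
  then show "\<bar>integral {- d..d} (W g) - integral {- d..d} (boltzmann g)\<bar> \<le> g"
    using b(1)[OF de(1)] b(1)[OF de(2)] mult_nonneg_nonneg[OF less_imp_le[OF assms] nn[of d]]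
      mult_nonneg_nonneg[OF less_imp_le[OF assms] nn[of "- d"]] by simp
  have "((\<lambda>s. f s / g * (f' s * boltzmann g s) + f s / g * boltzmann g s) has_integral
      (- (g + f d) * boltzmann g d - - (g + f (- d)) * boltzmann g (- d))
        + integral {- d..d} (\<lambda>s. f s / g * boltzmann g s)) {- d..d}"
    using int(2) by (intro has_integral_add local_FTC D(2)) (auto simp: has_integral_integral)
  moreover have "(\<lambda>s. f s / g * (f' s * boltzmann g s) + f s / g * boltzmann g s) = (\<lambda>s. f s / g * W g s)"
    by (auto simp: W_def algebra_simps add_divide_distrib)
  ultimately have "((\<lambda>s. f s / g * W g s) has_integral
      (- (g + f d) * boltzmann g d - - (g + f (- d)) * boltzmann g (- d))
        + integral {- d..d} (\<lambda>s. f s / g * boltzmann g s)) {- d..d}"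
    by metis
  then have "integral {- d..d} (\<lambda>s. f s / g * W g s) =
      (- (g + f d) * boltzmann g d - - (g + f (- d)) * boltzmann g (- d))
        + integral {- d..d} (\<lambda>s. f s / g * boltzmann g s)"
    by (rule integral_unique)
  moreover have "0 \<le> (g + f d) * boltzmann g d" "0 \<le> (g + f (- d)) * boltzmann g (- d)"
    using nn f_nonneg de assms by (auto intro!: mult_nonneg_nonneg add_nonneg_nonneg)
  ultimately show "\<bar>integral {- d..d} (\<lambda>s. f s / g * W g s)
        - integral {- d..d} (\<lambda>s. f s / g * boltzmann g s)\<bar> \<le> g"
    using b(2)[OF de(1)] b(2)[OF de(2)] unfolding mult_minus_left by linarith
  have "integral {- d..d} (\<lambda>s. (1 - s * f' s / g) * boltzmann g s) = d * boltzmann g d - - d * boltzmann g (- d)"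
    by (intro integral_unique local_FTC D(3))
  also have "\<dots> = d * (boltzmann g d + boltzmann g (- d))" by (simp add: algebra_simps)
  finally have "\<bar>integral {- d..d} (\<lambda>s. (1 - s * f' s / g) * boltzmann g s)\<bar>
      = d * (boltzmann g d + boltzmann g (- d))"
    using nn[of d] nn[of "- d"] d_pos by simp
  also have "\<dots> \<le> d * (g / f d + g / f (- d))"
    using b(3) de f_d_pos d_pos by (intro mult_left_mono add_mono) auto
  also have "\<dots> = d * (1 / f d + 1 / f (- d)) * g" by (simp add: algebra_simps)
  finally show "\<bar>integral {- d..d} (\<lambda>s. (1 - s * f' s / g) * boltzmann g s)\<bar> \<le> d * (1 / f d + 1 / f (- d)) * g" .
qed

section \<open>The quintic remainder under reflection\<close>

lemma local_bounds:
  obtains c H B1 B2 where "0 < c" "0 \<le> B1" "0 \<le> B2"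
    "\<And>s. s \<in> {- d..d} \<Longrightarrow> c \<le> h s" "\<And>s. s \<in> {- d..d} \<Longrightarrow> h s \<le> H"
    "\<And>s. s \<in> {- d..d} \<Longrightarrow> \<bar>h' s\<bar> \<le> B1" "\<And>s. s \<in> {- d..d} \<Longrightarrow> \<bar>h'' s\<bar> \<le> B2"
proof -
  have C: "continuous_on {- d..d} h" "continuous_on {- d..d} (\<lambda>s. \<bar>h' s\<bar>)"
    "continuous_on {- d..d} (\<lambda>s. \<bar>h'' s\<bar>)"
    using d_less isCont_h isCont_h' h''_cont
    by (auto intro!: continuous_on_cont continuous_intros)
  have ne: "{- d..d} \<noteq> {}" "0 \<in> {- d..d}" using d_pos by auto
  obtain x where x: "x \<in> {- d..d}" "\<And>y. y \<in> {- d..d} \<Longrightarrow> h x \<le> h y"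
    using continuous_attains_inf[OF compact_Icc ne(1) C(1)] by blast
  obtain y where y: "\<And>z. z \<in> {- d..d} \<Longrightarrow> h z \<le> h y"
    using continuous_attains_sup[OF compact_Icc ne(1) C(1)] by blast
  obtain u where u: "\<And>z. z \<in> {- d..d} \<Longrightarrow> \<bar>h' z\<bar> \<le> \<bar>h' u\<bar>"
    using continuous_attains_sup[OF compact_Icc ne(1) C(2)] by blast
  obtain v where v: "\<And>z. z \<in> {- d..d} \<Longrightarrow> \<bar>h'' z\<bar> \<le> \<bar>h'' v\<bar>"
    using continuous_attains_sup[OF compact_Icc ne(1) C(3)] by blast
  show thesis
    using x y u v h_pos d_less by (intro that[of "h x" "\<bar>h' u\<bar>" "\<bar>h'' v\<bar>" "h y"]) auto
qed

lemma reflection_bound: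
  assumes B: "\<And>s. s \<in> {- d..d} \<Longrightarrow> \<bar>p' s\<bar> \<le> B"
    and D: "\<And>s. - e < s \<Longrightarrow> (p has_real_derivative p' s) (at s)"
    and s: "0 \<le> s" "s \<le> d"
  shows "\<bar>p s - p (- s)\<bar> \<le> 2 * B * s"
proof -
  have "norm (p s - p (- s)) \<le> B * norm (s - (- s))"
    using B D d_less s
    by (intro field_differentiable_bound[of "{- d..d}" p p'])
       (auto intro: has_field_derivative_at_within)
  then show ?thesis using s by simp
qed

lemma abs_diff_exp_neg_le:
  fixes a b m :: real
  assumes "m \<le> a" "m \<le> b"
  shows "\<bar>exp (- a) - exp (- b)\<bar> \<le> \<bar>a - b\<bar> * exp (- m)"
proof -
  have *: "\<bar>exp (- a) - exp (- b)\<bar> \<le> \<bar>a - b\<bar> * exp (- m)" if "a \<le> b" "m \<le> a" for a b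
  proof -
    have "1 - exp (a - b) \<le> b - a" using exp_ge_add_one_self[of "a - b"] by linarith
    have "exp (- a) - exp (- b) = exp (- a) * (1 - exp (a - b))"
      by (simp add: algebra_simps flip: exp_add)
    also have "\<dots> \<le> exp (- m) * (b - a)"
      using that \<open>1 - exp (a - b) \<le> b - a\<close> by (intro mult_mono) auto
    finally show ?thesis using that by (simp add: mult.commute)
  qed
  show ?thesis
    using *[of a b] *[of b a] assms by (cases "a \<le> b") (auto simp: abs_minus_commute)
qed

text \<open>The leading term of \<open>s ^ 5 * h' s\<close> is odd: reflecting \<open>s\<close> gains a factor \<open>g powr (1/4)\<close>.\<close>

lemma quintic_remainder:
  obtains C where "0 \<le> C" "\<And>q. 0 < q \<Longrightarrow>
    \<bar>integral {- d..d} (\<lambda>s. s ^ 5 * h' s / q ^ 4 * boltzmann (q ^ 4) s)\<bar> \<le> C * q ^ 3"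
proof -
  obtain c H B1 B2 where B: "0 < c" "0 \<le> B1" "0 \<le> B2"
    "\<And>s. s \<in> {- d..d} \<Longrightarrow> c \<le> h s"
    "\<And>s. s \<in> {- d..d} \<Longrightarrow> \<bar>h' s\<bar> \<le> B1" "\<And>s. s \<in> {- d..d} \<Longrightarrow> \<bar>h'' s\<bar> \<le> B2"
    using local_bounds by metis
  define K where "K = (2 + 54 / c ^ 3) * pi"
  have K: "0 \<le> K" using B by (simp add: K_def)
  have "\<bar>integral {- d..d} (\<lambda>s. s ^ 5 * h' s / q ^ 4 * boltzmann (q ^ 4) s)\<bar> \<le> (2 * B2 * K + 2 * B1\<^sup>2 * K) * q ^ 3"
    if q: "0 < q" for q
  proof -
    define p where "p s = s ^ 5 * h' s / q ^ 4 * boltzmann (q ^ 4) s" for s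
    \<comment> \<open>The two terms bound the effect of reflection on \<open>h'\<close> and on the
      Boltzmann factor. Their moments scale as \<open>q ^ 7\<close> and \<open>q ^ 11\<close>, so
      after division by \<open>q ^ 4\<close> and \<open>q ^ 8\<close> both are of order
      \<open>q ^ 3\<close>.\<close>
    define k where "k s = 2 * B2 / q ^ 4 * (s ^ 6 * exp (- (c * s ^ 4 / q ^ 4)))
      + 2 * B1\<^sup>2 / q ^ 8 * (s ^ 10 * exp (- (c * s ^ 4 / q ^ 4)))" for s
    have cp: "isCont p s" if "- e < s" for s
      unfolding p_def using that q isCont_h' isCont_boltzmann by (auto intro!: continuous_intros)
    have int: "p integrable_on {- d..d}" "p integrable_on {0..d}" "p integrable_on {- d..0}"
      using d_pos d_less by (auto intro!: integrable_local cp)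
    have "integral {- d..d} p = integral {- d..0} p + integral {0..d} p"
      using d_pos int by (simp add: Henstock_Kurzweil_Integration.integral_combine)
    also have "integral {- d..0} p = integral {0..d} (\<lambda>s. p (- s))"
      using Henstock_Kurzweil_Integration.integral_reflect_real[of d 0 "\<lambda>s. p (- s)"] by simp
    also have "\<dots> + integral {0..d} p = integral {0..d} (\<lambda>s. p (- s) + p s)"
      using int Henstock_Kurzweil_Integration.integrable_reflect_real[of p 0 "- d"]
      by (intro Henstock_Kurzweil_Integration.integral_add[symmetric]) auto
    also have "norm \<dots> \<le> integral {0..d} k"
    proof (rule integral_norm_bound_integral)
      show "(\<lambda>s. p (- s) + p s) integrable_on {0..d}"
        using int Henstock_Kurzweil_Integration.integrable_reflect_real[of p 0 "- d"] by (intro integrable_add) auto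
      show "k integrable_on {0..d}" unfolding k_def
        using q by (intro integrable_continuous_interval continuous_intros) auto
      fix s assume s: "s \<in> {0..d}"
      define E where "E = exp (- (c * s ^ 4 / q ^ 4))"
      have le: "c * s ^ 4 / q ^ 4 \<le> f s / q ^ 4" "c * s ^ 4 / q ^ 4 \<le> f (- s) / q ^ 4"
        using B(4)[of s] B(4)[of "- s"] s d_less q
        by (auto simp: f_eq mult.commute intro!: divide_right_mono mult_right_mono)
      have "\<bar>boltzmann (q ^ 4) s - boltzmann (q ^ 4) (- s)\<bar> \<le> \<bar>f s / q ^ 4 - f (- s) / q ^ 4\<bar> * E"
        unfolding boltzmann_def E_def using le by (rule abs_diff_exp_neg_le)
      also have "f s / q ^ 4 - f (- s) / q ^ 4 = s ^ 4 / q ^ 4 * (h s - h (- s))"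
        using s d_less by (simp add: f_eq right_diff_distrib)
      also have "\<bar>s ^ 4 / q ^ 4 * (h s - h (- s))\<bar> \<le> s ^ 4 / q ^ 4 * (2 * B1 * s)"
        using reflection_bound[OF B(5) h_deriv, of s] s
        by (auto simp: abs_mult intro!: divide_right_mono mult_left_mono)
      finally have b: "\<bar>boltzmann (q ^ 4) s - boltzmann (q ^ 4) (- s)\<bar> \<le> s ^ 4 / q ^ 4 * (2 * B1 * s) * E"
        by (simp add: E_def)
      have bE: "\<bar>boltzmann (q ^ 4) s\<bar> \<le> E" using le by (simp add: boltzmann_def E_def)
      \<comment> \<open>As \<open>s ^ 5\<close> is odd, the sum is a difference of products.
        Splitting it leaves one difference in each summand, and each such difference supplies an
        additional factor \<open>s\<close>.\<close>
      have "p (- s) + p s = s ^ 5 / q ^ 4 * ((h' s - h' (- s)) * boltzmann (q ^ 4) s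
          + h' (- s) * (boltzmann (q ^ 4) s - boltzmann (q ^ 4) (- s)))"
        by (simp add: p_def algebra_simps)
      also have "norm \<dots> = s ^ 5 / q ^ 4 * \<bar>(h' s - h' (- s)) * boltzmann (q ^ 4) s
          + h' (- s) * (boltzmann (q ^ 4) s - boltzmann (q ^ 4) (- s))\<bar>"
        using s q by (simp add: abs_mult)
      also have "\<dots> \<le> s ^ 5 / q ^ 4 * (2 * B2 * s * E + B1 * (s ^ 4 / q ^ 4 * (2 * B1 * s) * E))"
      proof (rule mult_left_mono)
        have "\<bar>(h' s - h' (- s)) * boltzmann (q ^ 4) s\<bar> \<le> 2 * B2 * s * E"
          unfolding abs_mult using reflection_bound[OF B(6) h'_deriv, of s] bE s B(3)
          by (intro mult_mono) auto
        moreover have "\<bar>h' (- s) * (boltzmann (q ^ 4) s - boltzmann (q ^ 4) (- s))\<bar>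
            \<le> B1 * (s ^ 4 / q ^ 4 * (2 * B1 * s) * E)"
          unfolding abs_mult using B(5)[of "- s"] b s B(2) by (intro mult_mono) auto
        ultimately show "\<bar>(h' s - h' (- s)) * boltzmann (q ^ 4) s
          + h' (- s) * (boltzmann (q ^ 4) s - boltzmann (q ^ 4) (- s))\<bar>
          \<le> 2 * B2 * s * E + B1 * (s ^ 4 / q ^ 4 * (2 * B1 * s) * E)" by linarith
        show "0 \<le> s ^ 5 / q ^ 4" using s q by simp
      qed
      also have "\<dots> = k s"
      proof -
        have "s ^ 6 = s ^ 5 * s" "s ^ 10 = s ^ 5 * (s ^ 4 * s)" "q ^ 8 = q ^ 4 * q ^ 4"
          by (simp_all add: eval_nat_numeral)
        then show ?thesis
          unfolding k_def E_def[symmetric] power2_eq_square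
          by (simp only: times_divide_eq_left times_divide_eq_right distrib_left mult_ac divide_divide_eq_left)
      qed
      finally show "norm (p (- s) + p s) \<le> k s" .
    qed
    also have "integral {0..d} k = 2 * B2 / q ^ 4 * integral {0..d} (\<lambda>s. s ^ 6 * exp (- (c * s ^ 4 / q ^ 4)))
      + 2 * B1\<^sup>2 / q ^ 8 * integral {0..d} (\<lambda>s. s ^ 10 * exp (- (c * s ^ 4 / q ^ 4)))"
      unfolding k_def using q
      by (subst Henstock_Kurzweil_Integration.integral_add)
         (auto intro!: integrable_continuous_interval continuous_intros)
    also have "\<dots> \<le> 2 * B2 / q ^ 4 * (K * q ^ 7) + 2 * B1\<^sup>2 / q ^ 8 * (K * q ^ 11)"
      using integral_quartic_moment_le[OF B(1) d_pos q, of 6] integral_quartic_moment_le[OF B(1) d_pos q, of 10]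
        B(2,3) q by (intro add_mono mult_left_mono) (auto simp: K_def)
    also have "\<dots> = (2 * B2 * K + 2 * B1\<^sup>2 * K) * q ^ 3"
    proof -
      have "q ^ 7 / q ^ 4 = q ^ 3" "q ^ 11 / q ^ 8 = q ^ 3" using q by (simp_all flip: power_diff)
      then have "a / q ^ 4 * (K * q ^ 7) = a * K * q ^ 3" "a / q ^ 8 * (K * q ^ 11) = a * K * q ^ 3" for a
        by (metis times_divide_eq_left times_divide_eq_right mult.assoc)+
      then show ?thesis by (simp only: distrib_right)
    qed
    finally show ?thesis by (simp add: p_def)
  qed
  then show thesis using B K by (intro that[of "2 * B2 * K + 2 * B1\<^sup>2 * K"]) auto
qed

section \<open>Partition function and mean of the scaled action\<close>

definition Z :: "real \<Rightarrow> real" where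
  "Z g = (LINT s:{- d<..}|lborel. W g s)"

definition N :: "real \<Rightarrow> real" where
  "N g = (LINT s:{- d<..}|lborel. f s / g * W g s)"

lemma set_integrable_W:
  assumes "0 < g"
  shows "set_integrable lborel {- d<..} (W g)"
    and "set_integrable lborel {- d<..} (\<lambda>s. f s / g * W g s)"
  using LINT_split(1)[OF isCont_W(1) tail_W(1)] LINT_split(1)[OF isCont_W(2) tail_W(3)] assms by auto

text \<open>On \<open>{0..q * d}\<close> the exponent \<open>f s / q ^ 4\<close> is at most
  \<open>H * d ^ 4\<close>, so the integrand is bounded below independently of \<open>q\<close>; the
  length of this interval provides the factor \<open>q\<close>.\<close>

lemma Z_ge:
  obtains c where "0 < c" "\<And>q. 0 < q \<Longrightarrow> q \<le> 1 \<Longrightarrow> c * q \<le> Z (q ^ 4)"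
proof -
  obtain H where H: "\<And>s. s \<in> {- d..d} \<Longrightarrow> h s \<le> H"
    using local_bounds by metis
  have H0: "0 \<le> H" using H[of 0] h_pos[of 0] d_pos d_less by simp
  have "d * exp (- (H * d ^ 4)) * q \<le> Z (q ^ 4)" if q: "0 < q" "q \<le> 1" for q
  proof -
    have g: "0 < q ^ 4" using q by simp
    have qd: "0 \<le> q * d" "q * d \<le> d" using q d_pos by (auto simp: mult_left_le_one_le)
    have "integral {0..q * d} (\<lambda>s. exp (- (H * d ^ 4))) \<le> integral {0..q * d} (W (q ^ 4))"
    proof (rule integral_le)
      fix s assume s: "s \<in> {0..q * d}"
      then have s': "s \<in> {- d..d}" using qd by auto
      have "f s \<le> H * (q * d) ^ 4"
        using s s' H[OF s'] d_less H0
        by (auto simp: f_eq mult.commute[of _ "h s"] intro!: mult_mono power_mono)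
      then have "f s / q ^ 4 \<le> H * d ^ 4"
        using q by (simp add: field_simps power_mult_distrib)
      then have "1 * exp (- (H * d ^ 4)) \<le> W (q ^ 4) s"
        unfolding W_def boltzmann_def using f'_nonneg[of s] s by (intro mult_mono) auto
      then show "exp (- (H * d ^ 4)) \<le> W (q ^ 4) s" by simp
    qed (use d_pos d_less g in \<open>auto intro!: integrable_local isCont_W(1)\<close>)
    also have "\<dots> \<le> integral {- d..d} (W (q ^ 4))"
      using qd d_pos d_less g
      by (intro integral_subset_le integrable_local isCont_W(1)) (auto intro!: W_nonneg)
    also have "\<dots> \<le> Z (q ^ 4)"
      unfolding Z_def using LINT_split(2)[OF isCont_W(1)[OF _ g] tail_W(1)[OF g]] tail_W(2)[OF g] by simp
    finally show ?thesis using qd by (simp add: mult_ac)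
  qed
  then show thesis using d_pos by (intro that[of "d * exp (- (H * d ^ 4))"]) auto
qed

text \<open>This covers every \<open>g > 0\<close>, whereas the quantitative lower bound is
  restricted to \<open>q \<le> 1\<close>; the theorem asserts a positive normalization for all
  \<open>g\<close>.\<close>

lemma Z_pos:
  assumes "0 < g"
  shows "0 < Z g"
proof -
  have "continuous_on {0..d} (W g)"
    using d_pos d_less by (intro continuous_on_cont isCont_W(1) assms) auto
  moreover have "0 < W g s" if "s \<in> {0..d}" for s
    using f'_nonneg[of s] boltzmann_pos[of g s] that by (auto simp: W_def)
  moreover obtain x where x: "x \<in> {0..d}" "\<And>y. y \<in> {0..d} \<Longrightarrow> W g x \<le> W g y"
    using continuous_attains_inf[OF compact_Icc _ calculation(1)] d_pos by force
  ultimately have "0 < d * W g x" using d_pos by simp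
  also have "\<dots> = integral {0..d} (\<lambda>s. W g x)" using d_pos by simp
  also have "\<dots> \<le> integral {0..d} (W g)"
    using x d_pos d_less assms by (intro integral_le integrable_local isCont_W(1)) auto
  also have "\<dots> \<le> integral {- d..d} (W g)"
    using d_pos d_less assms
    by (intro integral_subset_le integrable_local isCont_W(1)) (auto intro!: W_nonneg)
  also have "\<dots> \<le> Z g"
    unfolding Z_def using LINT_split(2)[OF isCont_W(1)[OF _ assms] tail_W(1)[OF assms]] tail_W(2)[OF assms] by simp
  finally show ?thesis .
qed

text \<open>Integrating \<open>s * boltzmann g s\<close> by parts replaces \<open>f / g - 1/4\<close> by
  \<open>(f - s * f' / 4) / g\<close>, whose numerator vanishes on the pure quartic and equals \<open>- s ^ 5 * h' / 4\<close> in general.\<close>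

lemma local_virial:
  assumes "0 < g"
  shows "integral {- d..d} (\<lambda>s. f s / g * boltzmann g s) - integral {- d..d} (boltzmann g) / 4
    = - (integral {- d..d} (\<lambda>s. (1 - s * f' s / g) * boltzmann g s)
         + integral {- d..d} (\<lambda>s. s ^ 5 * h' s / g * boltzmann g s)) / 4"
proof -
  have int: "p integrable_on {- d..d}" if "\<And>s. - e < s \<Longrightarrow> isCont p s" for p :: "real \<Rightarrow> real"
    using that d_less by (intro integrable_local) auto
  note i = int[of "\<lambda>s. f s / g * boltzmann g s"] int[of "boltzmann g"]
    int[of "\<lambda>s. (1 - s * f' s / g) * boltzmann g s"] int[of "\<lambda>s. s ^ 5 * h' s / g * boltzmann g s"]
  have I: "((\<lambda>s. - (((1 - s * f' s / g) * boltzmann g s + s ^ 5 * h' s / g * boltzmann g s) / 4)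
      + boltzmann g s / 4) has_integral
    - ((integral {- d..d} (\<lambda>s. (1 - s * f' s / g) * boltzmann g s)
         + integral {- d..d} (\<lambda>s. s ^ 5 * h' s / g * boltzmann g s)) / 4)
      + integral {- d..d} (boltzmann g) / 4) {- d..d}"
    using assms isCont_boltzmann isCont_f' isCont_h'
    by (intro has_integral_add has_integral_neg has_integral_divide integrable_integral i)
       (auto intro!: continuous_intros)
  have "integral {- d..d} (\<lambda>s. f s / g * boltzmann g s) =
    - ((integral {- d..d} (\<lambda>s. (1 - s * f' s / g) * boltzmann g s)
         + integral {- d..d} (\<lambda>s. s ^ 5 * h' s / g * boltzmann g s)) / 4)
      + integral {- d..d} (boltzmann g) / 4"
  proof (intro integral_unique has_integral_eq[OF _ I])
    fix s assume "s \<in> {- d..d}"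
    then have s: "- e < s" using d_less by auto
    have "s * f' s = 4 * f s + s ^ 5 * h' s"
      by (simp add: f'_eq[OF s] f_eq[OF s] eval_nat_numeral algebra_simps)
    then have "- ((1 - s * f' s / g + s ^ 5 * h' s / g) / 4) + 1 / 4 = f s / g"
      by (simp add: add_divide_distrib diff_divide_distrib)
    then have "(- ((1 - s * f' s / g + s ^ 5 * h' s / g) / 4) + 1 / 4) * boltzmann g s = f s / g * boltzmann g s"
      by simp
    then show "- (((1 - s * f' s / g) * boltzmann g s + s ^ 5 * h' s / g * boltzmann g s) / 4)
      + boltzmann g s / 4 = f s / g * boltzmann g s"
      by (simp add: algebra_simps)
  qed
  then show ?thesis by linarith
qed

lemma N_minus_quarter_Z:
  obtains C where "0 \<le> C" "\<And>q. 0 < q \<Longrightarrow> q \<le> 1 \<Longrightarrow> \<bar>N (q ^ 4) - Z (q ^ 4) / 4\<bar> \<le> C * q ^ 3"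
proof -
  obtain C where C: "0 \<le> C" "\<And>q. 0 < q \<Longrightarrow>
    \<bar>integral {- d..d} (\<lambda>s. s ^ 5 * h' s / q ^ 4 * boltzmann (q ^ 4) s)\<bar> \<le> C * q ^ 3"
    using quintic_remainder by blast
  define K where "K = 1 + 1 / f' d"
  define b where "b = d * (1 / f d + 1 / f (- d))"
  have "0 \<le> K" "0 \<le> b" using f'_d_pos f_d_pos d_pos by (auto simp: K_def b_def)
  have "\<bar>N (q ^ 4) - Z (q ^ 4) / 4\<bar> \<le> (2 * K + 2 + b + C) * q ^ 3" if q: "0 < q" "q \<le> 1" for q
  proof -
    \<comment> \<open>All errors of order \<open>g = q ^ 4\<close> are weakened to order
      \<open>q ^ 3\<close>, the size of the quintic remainder.\<close>
    have g: "0 < q ^ 4" "q ^ 4 \<le> q ^ 3" using q by (auto intro: power_decreasing)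
    have Z: "Z (q ^ 4) = integral {- d..d} (W (q ^ 4)) + (LINT s:{d<..}|lborel. W (q ^ 4) s)"
      unfolding Z_def by (rule LINT_split(2)[OF isCont_W(1)[OF _ g(1)] tail_W(1)[OF g(1)]])
    have N: "N (q ^ 4) = integral {- d..d} (\<lambda>s. f s / q ^ 4 * W (q ^ 4) s)
        + (LINT s:{d<..}|lborel. f s / q ^ 4 * W (q ^ 4) s)"
      unfolding N_def by (rule LINT_split(2)[OF isCont_W(2)[OF _ g(1)] tail_W(3)[OF g(1)]])
    have T: "(LINT s:{d<..}|lborel. W (q ^ 4) s) \<in> {0..K * q ^ 4}"
      "(LINT s:{d<..}|lborel. f s / q ^ 4 * W (q ^ 4) s) \<in> {0..K * q ^ 4}"
      using tail_W(2,4)[OF g(1)] by (auto simp: K_def)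
    have "\<bar>N (q ^ 4) - Z (q ^ 4) / 4\<bar> \<le> 2 * (K * q ^ 4) + 2 * q ^ 4 + b * q ^ 4 + C * q ^ 3"
    proof -
      \<comment> \<open>Abstracting the integrals leaves linear arithmetic: index 1 belongs to
        \<open>N\<close> and 2 to \<open>Z\<close>, \<open>x\<close> and \<open>t\<close> are window
        and tail, \<open>y\<close> is the window integral with flat measure, \<open>v\<close> the
        boundary term and \<open>w\<close> the quintic remainder.\<close>
      have "\<bar>x\<^sub>1 + t\<^sub>1 - (x\<^sub>2 + t\<^sub>2) / 4\<bar> \<le> 2 * k + 2 * \<epsilon> + v' + w'"
        if "t\<^sub>1 \<in> {0..k}" "t\<^sub>2 \<in> {0..k}" "\<bar>x\<^sub>1 - y\<^sub>1\<bar> \<le> \<epsilon>" "\<bar>x\<^sub>2 - y\<^sub>2\<bar> \<le> \<epsilon>"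
          "\<bar>v\<bar> \<le> v'" "\<bar>w\<bar> \<le> w'" "y\<^sub>1 - y\<^sub>2 / 4 = - (v + w) / 4"
        for x\<^sub>1 x\<^sub>2 y\<^sub>1 y\<^sub>2 t\<^sub>1 t\<^sub>2 k \<epsilon> v w v' w' :: real
        using that unfolding atLeastAtMost_iff by argo
      from this[OF T(2,1) local_W(2,1)[OF g(1)] local_W(3)[OF g(1), folded b_def] C(2)[OF q(1)]
          local_virial[OF g(1)]]
      show ?thesis unfolding N Z .
    qed
    also have "\<dots> = (2 * K + 2 + b) * q ^ 4 + C * q ^ 3" by (simp add: algebra_simps)
    also have "\<dots> \<le> (2 * K + 2 + b) * q ^ 3 + C * q ^ 3"
      using g \<open>0 \<le> K\<close> \<open>0 \<le> b\<close> by (intro add_right_mono mult_left_mono) auto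
    finally show ?thesis by (simp add: algebra_simps)
  qed
  then show thesis using C(1) \<open>0 \<le> K\<close> \<open>0 \<le> b\<close> by (intro that[of "2 * K + 2 + b + C"]) auto
qed

theorem mean_quarter: "(\<lambda>g. N g / Z g - 1 / 4) \<in> O[at_right 0](\<lambda>g. g powr (1 / 2))"
proof -
  obtain C where C: "0 \<le> C" "\<And>q. 0 < q \<Longrightarrow> q \<le> 1 \<Longrightarrow> \<bar>N (q ^ 4) - Z (q ^ 4) / 4\<bar> \<le> C * q ^ 3"
    using N_minus_quarter_Z by blast
  obtain c where c: "0 < c" "\<And>q. 0 < q \<Longrightarrow> q \<le> 1 \<Longrightarrow> c * q \<le> Z (q ^ 4)"
    using Z_ge by blast
  have "norm (N g / Z g - 1 / 4) \<le> C / c * norm (g powr (1 / 2))" if g: "0 < g" "g < 1" for g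
  proof -
    define q where "q = g powr (1 / 4)"
    have q: "0 < q" "q \<le> 1" "g = q ^ 4" "g powr (1 / 2) = q\<^sup>2"
      using g by (auto simp: q_def powr_le1 powr_power)
    have Z: "0 < Z g" using Z_pos g by simp
    have "norm (N g / Z g - 1 / 4) = \<bar>N g - Z g / 4\<bar> / Z g"
      using Z by (simp add: field_simps abs_divide)
    also have "\<dots> \<le> C * q ^ 3 / (c * q)"
      using C(2)[OF q(1,2)] c(2)[OF q(1,2)] c(1) C(1) q Z
      by (intro frac_le) auto
    also have "\<dots> = C / c * norm (g powr (1 / 2))"
      using q by (simp add: eval_nat_numeral)
    finally show ?thesis .
  qed
  then show ?thesis
    by (intro bigoI[of _ "C / c"]) (auto simp: eventually_at_right_field intro!: exI[of _ 1])
qed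

end

section \<open>The critical Kerr-AdS mass function\<close>

text \<open>A derivative at a point depends on nearby values, so the formula for the previous order
  must be known on an open set.\<close>

lemma deriv_funpow_Suc_eq:
  fixes u p :: "real \<Rightarrow> real"
  assumes "open S" "x \<in> S" "\<And>y. y \<in> S \<Longrightarrow> (deriv ^^ n) u y = p y"
    and "(p has_real_derivative p') (at x)"
  shows "(deriv ^^ Suc n) u x = p'"
proof -
  have "((deriv ^^ n) u has_real_derivative p') (at x)"
    by (rule has_field_derivative_transform_within_open[OF assms(4,1,2)]) (simp add: assms(3))
  then have "deriv ((deriv ^^ n) u) x = p'" by (rule DERIV_imp_deriv)
  then show ?thesis by simp
qed

lemma ex1_critical_cubic: "\<exists>!x::real. x > 0 \<and> 8*x^3 + 10*x^2 + 2*x - 1 = 0"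
proof (rule ex_ex1I)
  have "\<exists>x\<ge>0. x \<le> 1 \<and> 8*x^3 + 10*x^2 + 2*x - 1 = (0::real)"
    by (intro IVT'[of "\<lambda>x. 8*x^3 + 10*x^2 + 2*x - 1"] continuous_intros) auto
  then obtain x :: real where "0 \<le> x" "8*x^3 + 10*x^2 + 2*x - 1 = 0" by blast
  moreover from this have "x \<noteq> 0" by (intro notI) simp
  ultimately show "\<exists>x::real. x > 0 \<and> 8*x^3 + 10*x^2 + 2*x - 1 = 0"
    by (intro exI[of _ x] conjI) simp_all
next
  have less: "8*x^3 + 10*x^2 + 2*x < 8*y^3 + 10*y^2 + 2*y" if "0 < x" "x < y" for x y :: real
    using that power_strict_mono[of x y 3] power_strict_mono[of x y 2] by simp
  show "x = y" if "x > 0 \<and> 8*x^3 + 10*x^2 + 2*x - 1 = 0" "y > 0 \<and> 8*y^3 + 10*y^2 + 2*y - 1 = 0"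
    for x y :: real
    using that less[of x y] less[of y x] by linarith
qed

lemma chi_c_pos: "0 < chi_c" and chi_c_root: "8*chi_c^3 + 10*chi_c^2 + 2*chi_c - 1 = 0"
  using theI'[OF ex1_critical_cubic, folded chi_c_def] by auto

text \<open>\<open>r0, \<dots>, r4\<close> are \<open>R_K\<close> at \<open>4 * j_c^2 = chi_c^4\<close> and its \<open>x\<close>-derivatives; \<open>F1, F2, F3\<close> are
  the \<open>x\<close>-derivatives of the mass at \<open>\<sigma> = pi * x\<close>.\<close>

definition r0 :: "real \<Rightarrow> real" where "r0 x = x^3 + 2*x^2 + x + chi_c^4 + chi_c^4 / x"
definition r1 :: "real \<Rightarrow> real" where "r1 x = 3*x^2 + 4*x + 1 - chi_c^4 / x^2"
definition r2 :: "real \<Rightarrow> real" where "r2 x = 6*x + 4 + 2*chi_c^4 / x^3"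
definition r3 :: "real \<Rightarrow> real" where "r3 x = 6 - 6*chi_c^4 / x^4"
definition r4 :: "real \<Rightarrow> real" where "r4 x = 24*chi_c^4 / x^5"
text \<open>The numerator of the second derivative of \<open>sqrt r0\<close>; its sign is that of
  the second derivative of the mass.\<close>

definition Q :: "real \<Rightarrow> real" where "Q x = 2 * r0 x * r2 x - (r1 x)^2"

definition F1 :: "real \<Rightarrow> real" where "F1 x = r1 x / (4 * sqrt (r0 x))"
definition F2 :: "real \<Rightarrow> real" where "F2 x = Q x / (8 * sqrt (r0 x) ^ 3)"
definition F3 :: "real \<Rightarrow> real" where
  "F3 x = (4 * (r0 x)^2 * r3 x - 3 * Q x * r1 x) / (16 * sqrt (r0 x) ^ 5)"

lemma R_K_j_c: "R_K x j_c = r0 x"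
  by (simp add: R_K_def j_c_def r0_def power_divide flip: power_mult)

lemma r0_pos: "0 < r0 x" if "0 < x"
  using that chi_c_pos by (simp add: r0_def add_pos_pos)

section \<open>Derivatives in the horizon variable\<close>

lemma DERIV_const_over_power:
  fixes x :: real
  assumes "0 < x"
  shows "((\<lambda>x. a / x ^ Suc n) has_real_derivative - (real (Suc n) * a / x ^ Suc (Suc n))) (at x)"
proof -
  have "((\<lambda>x. x ^ Suc n) has_real_derivative real (Suc n) * x ^ n) (at x)"
    using DERIV_pow[of "Suc n" x] by simp
  then have "((\<lambda>x. a * inverse (x ^ Suc n)) has_real_derivative
      a * - (real (Suc n) * x ^ n * inverse ((x ^ Suc n) ^ Suc (Suc 0)))) (at x)"
    using assms by (intro DERIV_cmult DERIV_inverse_fun) auto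
  also have "a * - (real (Suc n) * x ^ n * inverse ((x ^ Suc n) ^ Suc (Suc 0)))
      = - (real (Suc n) * a / x ^ Suc (Suc n))"
    using assms by (simp add: divide_simps)
  finally show ?thesis by (simp only: divide_inverse)
qed

lemma DERIV_r:
  assumes "0 < x"
  shows "(r0 has_real_derivative r1 x) (at x)" "(r1 has_real_derivative r2 x) (at x)"
    "(r2 has_real_derivative r3 x) (at x)" "(r3 has_real_derivative r4 x) (at x)"
proof -
  note * = DERIV_const_over_power[OF assms]
  have 1: "((\<lambda>x. chi_c^4 / x) has_real_derivative - (chi_c^4 / x^2)) (at x)"
    using *[of "chi_c^4" 0] by (simp add: power2_eq_square)
  have 2: "((\<lambda>x. chi_c^4 / x^2) has_real_derivative - (2 * chi_c^4 / x^3)) (at x)"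
    using *[of "chi_c^4" 1] by (simp add: eval_nat_numeral del: power_Suc)
  have 3: "((\<lambda>x. 2 * chi_c^4 / x^3) has_real_derivative - (6 * chi_c^4 / x^4)) (at x)"
    using *[of "2 * chi_c^4" 2] by (simp add: eval_nat_numeral del: power_Suc)
  have 4: "((\<lambda>x. 6 * chi_c^4 / x^4) has_real_derivative - (24 * chi_c^4 / x^5)) (at x)"
    using *[of "6 * chi_c^4" 3] by (simp add: eval_nat_numeral del: power_Suc)
  show "(r0 has_real_derivative r1 x) (at x)"
    unfolding r0_def r1_def by (rule derivative_eq_intros 1 refl | simp)+
  show "(r1 has_real_derivative r2 x) (at x)"
    unfolding r1_def r2_def by (rule derivative_eq_intros 2 refl | simp)+
  show "(r2 has_real_derivative r3 x) (at x)"
    unfolding r2_def r3_def by (rule derivative_eq_intros 3 refl | simp)+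
  show "(r3 has_real_derivative r4 x) (at x)"
    unfolding r3_def r4_def by (rule derivative_eq_intros 4 refl | simp)+
qed

text \<open>The two contributions \<open>2 * r1 x * r2 x\<close> cancel, so the monotonicity of
  \<open>Q\<close> depends on the sign of \<open>r3\<close> alone.\<close>

lemma DERIV_Q: "(Q has_real_derivative 2 * r0 x * r3 x) (at x)" if "0 < x"
  unfolding Q_def using DERIV_r[OF that]
  by - (rule DERIV_cong, rule derivative_intros | assumption | simp add: algebra_simps)+

lemma DERIV_sqrt_r0: "((\<lambda>x. sqrt (r0 x)) has_real_derivative r1 x / (2 * sqrt (r0 x))) (at x)" if "0 < x"
proof -
  have "((\<lambda>x. sqrt (r0 x)) has_real_derivative inverse (sqrt (r0 x)) / 2 * r1 x) (at x)"
    by (rule DERIV_chain2[where f = sqrt and g = r0, OF DERIV_real_sqrt[OF r0_pos[OF that]] DERIV_r(1)[OF that]])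
  then show ?thesis by (rule DERIV_cong) (simp add: inverse_eq_divide)
qed

lemma DERIV_F:
  assumes "0 < x"
  shows "((\<lambda>x. sqrt (r0 x) / 2) has_real_derivative F1 x) (at x)"
    and "(F1 has_real_derivative F2 x) (at x)"
    and "(F2 has_real_derivative F3 x) (at x)"
proof -
  note D = DERIV_r[OF assms] DERIV_Q[OF assms] DERIV_sqrt_r0[OF assms]
  define S where "S = sqrt (r0 x)"
  have S: "0 < S" "r0 x = S\<^sup>2" using r0_pos[OF assms] by (auto simp: S_def)
  show "((\<lambda>x. sqrt (r0 x) / 2) has_real_derivative F1 x) (at x)"
    unfolding F1_def by (rule DERIV_cong[OF DERIV_cdivide[OF DERIV_sqrt_r0[OF assms], of 2]]) simp
  have "(F1 has_real_derivative (r2 x * (4 * S) - r1 x * (4 * (r1 x / (2 * S)))) / (4 * S * (4 * S))) (at x)"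
    unfolding F1_def S_def using S(1)
    by (intro DERIV_divide DERIV_cmult D) (simp add: S_def)
  also have "(r2 x * (4 * S) - r1 x * (4 * (r1 x / (2 * S)))) / (4 * S * (4 * S)) = F2 x"
    unfolding F2_def Q_def S_def[symmetric] S(2) using S(1) by (simp add: divide_simps) algebra
  finally show "(F1 has_real_derivative F2 x) (at x)" .
  have "(F2 has_real_derivative (2 * r0 x * r3 x * (8 * S ^ 3) - Q x * (8 * (3 * S\<^sup>2 * (r1 x / (2 * S)))))
      / (8 * S ^ 3 * (8 * S ^ 3))) (at x)"
    unfolding F2_def S_def using S(1)
    by (intro DERIV_divide DERIV_cmult DERIV_cong[OF DERIV_power[OF DERIV_sqrt_r0[OF assms], of 3]] D)
       (simp_all add: S_def)
  also have "(2 * r0 x * r3 x * (8 * S ^ 3) - Q x * (8 * (3 * S\<^sup>2 * (r1 x / (2 * S)))))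
      / (8 * S ^ 3 * (8 * S ^ 3)) = F3 x"
    unfolding F3_def S_def[symmetric] S(2) using S(1) by (simp add: divide_simps) algebra
  finally show "(F2 has_real_derivative F3 x) (at x)" .
qed

text \<open>The choice \<open>4 * j_c^2 = chi_c^4\<close> is exactly what makes \<open>r3\<close>
  vanish at \<open>chi_c\<close>; the other values lose their denominators for the same reason,
  except \<open>r4\<close>.\<close>

lemma r_chi_c:
  "r0 chi_c = chi_c^4 + 2*chi_c^3 + 2*chi_c^2 + chi_c" "r1 chi_c = B_c" "r2 chi_c = 8*chi_c + 4"
  "r3 chi_c = 0" "r4 chi_c = 24 / chi_c"
  unfolding r0_def r1_def r2_def r3_def r4_def B_c_def
  using chi_c_pos by (simp add: divide_simps, algebra?)+

text \<open>The criticality condition \<open>Q chi_c = 0\<close> in disguise. The cubic enters here,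
  as a factor of the defect.\<close>

lemma B_c_sq: "B_c\<^sup>2 = 2 * r0 chi_c * (8 * chi_c + 4)"
proof -
  have "2 * r0 chi_c * (8 * chi_c + 4) - B_c\<^sup>2
      = (8*chi_c^3 + 10*chi_c^2 + 2*chi_c - 1) * (2*chi_c^2 + 2*chi_c + 1)"
    unfolding r_chi_c B_c_def by algebra
  then show ?thesis by (simp add: chi_c_root)
qed

lemma B_c_pos: "0 < B_c"
  using chi_c_pos by (simp add: B_c_def add_pos_pos)

lemma Q_chi_c: "Q chi_c = 0"
  using B_c_sq by (simp add: Q_def r_chi_c)

text \<open>\<open>Q' = 2 * r0 * r3\<close> is nonpositive before \<open>chi_c\<close> and
  nonnegative after it, so \<open>Q\<close> attains its minimum, zero, at \<open>chi_c\<close>. This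
  is the convexity of the mass at \<open>j_c\<close>.\<close>

lemma Q_nonneg: "0 \<le> Q x" if "0 < x"
proof (cases "chi_c \<le> x")
  case True
  have "Q chi_c \<le> Q x"
  proof (rule DERIV_nonneg_imp_nondecreasing[OF True])
    fix y assume "chi_c \<le> y" "y \<le> x"
    moreover from this have "0 < y" using chi_c_pos by simp
    ultimately have "chi_c^4 / y^4 \<le> 1" using chi_c_pos by (simp add: power_mono)
    then show "\<exists>z. (Q has_real_derivative z) (at y) \<and> 0 \<le> z"
      using DERIV_Q[OF \<open>0 < y\<close>] r0_pos[OF \<open>0 < y\<close>] by (auto simp: r3_def)
  qed
  then show ?thesis by (simp add: Q_chi_c)
next
  case False
  have "Q chi_c \<le> Q x"
  proof (rule DERIV_nonpos_imp_nonincreasing[of x chi_c Q])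
    show "x \<le> chi_c" using False by simp
    fix y assume "x \<le> y" "y \<le> chi_c"
    moreover from this have "0 < y" using that by simp
    ultimately have "1 \<le> chi_c^4 / y^4" by (simp add: power_mono)
    then show "\<exists>z. (Q has_real_derivative z) (at y) \<and> z \<le> 0"
      using DERIV_Q[OF \<open>0 < y\<close>] r0_pos[OF \<open>0 < y\<close>] by (auto simp: r3_def mult_nonneg_nonpos)
  qed
  then show ?thesis by (simp add: Q_chi_c)
qed

section \<open>The extremal horizon\<close>

lemma r1_strict_mono: "r1 x < r1 y" if "0 < x" "x < y"
proof -
  have "chi_c^4 / y^2 \<le> chi_c^4 / x^2"
    using that by (intro divide_left_mono power_mono mult_pos_pos) auto
  moreover have "x^2 < y^2" using that by (intro power_strict_mono) auto
  ultimately show ?thesis using that by (simp add: r1_def)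
qed

lemma r1_eq_0_iff: "r1 x = 0 \<longleftrightarrow> 3*x^4 + 4*x^3 + x^2 - chi_c^4 = 0" if "0 < x"
proof -
  have "x^2 * r1 x = 3*x^4 + 4*x^3 + x^2 - chi_c^4"
    unfolding r1_def using that by (simp add: divide_simps) algebra
  then show ?thesis using that by (metis mult_eq_0_iff power_not_zero less_irrefl)
qed

lemma ex1_extremal: "\<exists>!x. 0 < x \<and> r1 x = 0"
proof (rule ex_ex1I)
  \<comment> \<open>At 0 the polynomial is \<open>- chi_c^4\<close>, which also excludes the root 0;
    at \<open>chi_c\<close> it is \<open>2*chi_c^4 + 4*chi_c^3 + chi_c^2\<close>.\<close>
  have "\<exists>x\<ge>0. x \<le> chi_c \<and> 3*x^4 + 4*x^3 + x^2 - chi_c^4 = 0"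
    using chi_c_pos by (intro IVT'[of "\<lambda>x. 3*x^4 + 4*x^3 + x^2 - chi_c^4"] continuous_intros) auto
  then obtain x where x: "0 \<le> x" "3*x^4 + 4*x^3 + x^2 - chi_c^4 = 0" by blast
  then have "x \<noteq> 0" using chi_c_pos by auto
  with x show "\<exists>x. 0 < x \<and> r1 x = 0" using r1_eq_0_iff[of x] by (intro exI[of _ x]) auto
next
  show "x = y" if "0 < x \<and> r1 x = 0" "0 < y \<and> r1 y = 0" for x y
    using that r1_strict_mono[of x y] r1_strict_mono[of y x] by (cases x y rule: linorder_cases) auto
qed

section \<open>Entropy derivatives of mass and action\<close>

lemma DERIV_scale_pi:
  assumes "(p has_real_derivative p') (at (\<sigma> / pi))"
  shows "((\<lambda>s. p (s / pi) / pi ^ n) has_real_derivative p' / pi ^ Suc n) (at \<sigma>)"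
proof -
  have "((\<lambda>s. p (s / pi)) has_real_derivative p' * (1 / pi)) (at \<sigma>)"
    using assms by (intro DERIV_chain2[of p]) (auto intro!: derivative_eq_intros)
  from DERIV_cdivide[OF this, of "pi ^ n"] show ?thesis by (simp add: mult.commute)
qed

lemma m_K_eq: "m_K \<sigma> j_c = sqrt (r0 (\<sigma> / pi)) / 2"
  by (simp add: m_K_def R_K_j_c)

text \<open>The trivial division by \<open>pi ^ 0\<close> puts order 0 into the shape that
  \<open>dm_K_Suc\<close> expects.\<close>

lemma dm_K_0: "dm_K 0 \<sigma> j_c = sqrt (r0 (\<sigma> / pi)) / 2 / pi ^ 0"
  by (simp add: dm_K_def m_K_eq)

lemma dm_K_Suc:
  assumes "\<And>s. 0 < s \<Longrightarrow> dm_K n s j_c = p (s / pi) / pi ^ n"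
    and "(p has_real_derivative p') (at (\<sigma> / pi))" and "0 < \<sigma>"
  shows "dm_K (Suc n) \<sigma> j_c = p' / pi ^ Suc n"
  unfolding dm_K_def using assms DERIV_scale_pi[OF assms(2), of n]
  by (intro deriv_funpow_Suc_eq[of "{0<..}"]) (auto simp: dm_K_def)

lemma dm_K_1: "dm_K 1 \<sigma> j_c = F1 (\<sigma> / pi) / pi" if "0 < \<sigma>"
  using dm_K_Suc[OF dm_K_0 DERIV_F(1) that] that by simp

lemma dm_K_2: "dm_K 2 \<sigma> j_c = F2 (\<sigma> / pi) / pi ^ 2" if "0 < \<sigma>"
  using dm_K_Suc[of 1 F1] dm_K_1 DERIV_F(2) that by (simp add: numeral_2_eq_2)

lemma dm_K_3: "dm_K 3 \<sigma> j_c = F3 (\<sigma> / pi) / pi ^ 3" if "0 < \<sigma>"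
  using dm_K_Suc[of 2 F2] dm_K_2 DERIV_F(3) that by (simp add: numeral_3_eq_3 numeral_2_eq_2)

text \<open>Iterated \<open>deriv\<close> carries no differentiability by itself; it is transferred
  from \<open>F1\<close> and \<open>F2\<close> along the open half-line on which the formulas
  agree.\<close>

lemma DERIV_dm_K:
  assumes "0 < \<sigma>"
  shows "((\<lambda>s. m_K s j_c) has_real_derivative dm_K 1 \<sigma> j_c) (at \<sigma>)"
    and "((\<lambda>s. dm_K 1 s j_c) has_real_derivative dm_K 2 \<sigma> j_c) (at \<sigma>)"
    and "((\<lambda>s. dm_K 2 s j_c) has_real_derivative dm_K 3 \<sigma> j_c) (at \<sigma>)"
proof -
  have x: "0 < \<sigma> / pi" using assms by simp
  show "((\<lambda>s. m_K s j_c) has_real_derivative dm_K 1 \<sigma> j_c) (at \<sigma>)"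
    using DERIV_scale_pi[OF DERIV_F(1)[OF x], of 0] assms by (simp add: m_K_eq dm_K_1[unfolded One_nat_def])
  have "((\<lambda>s. F1 (s / pi) / pi) has_real_derivative dm_K 2 \<sigma> j_c) (at \<sigma>)"
    using DERIV_scale_pi[OF DERIV_F(2)[OF x], of 1] assms by (simp add: dm_K_2 power2_eq_square)
  then show "((\<lambda>s. dm_K 1 s j_c) has_real_derivative dm_K 2 \<sigma> j_c) (at \<sigma>)"
    by (rule has_field_derivative_transform_within_open[of _ _ _ "{0<..}"])
       (use assms in \<open>auto simp: dm_K_1[unfolded One_nat_def]\<close>)
  have "((\<lambda>s. F2 (s / pi) / pi ^ 2) has_real_derivative dm_K 3 \<sigma> j_c) (at \<sigma>)"
    using DERIV_scale_pi[OF DERIV_F(3)[OF x], of 2] assms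
    by (simp add: dm_K_3 power2_eq_square power3_eq_cube mult.assoc)
  then show "((\<lambda>s. dm_K 2 s j_c) has_real_derivative dm_K 3 \<sigma> j_c) (at \<sigma>)"
    by (rule has_field_derivative_transform_within_open[of _ _ _ "{0<..}"]) (use assms in \<open>auto simp: dm_K_2\<close>)
qed

lemma sigma_c_pos: "0 < sigma_c" and sigma_c_div_pi: "sigma_c / pi = chi_c"
  using chi_c_pos by (auto simp: sigma_c_def)

lemma dm_K_critical: "dm_K 2 sigma_c j_c = 0" "dm_K 3 sigma_c j_c = 0"
  using sigma_c_pos by (simp_all add: dm_K_2 dm_K_3 sigma_c_div_pi F2_def F3_def Q_chi_c r_chi_c)

lemma tau_c_eq: "tau_c = B_c / (4 * pi * sqrt (r0 chi_c))"
  using dm_K_1[OF sigma_c_pos] by (simp add: tau_c_def sigma_c_div_pi F1_def r_chi_c mult_ac)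

lemma tau_c_pos: "0 < tau_c"
  using B_c_pos r0_pos[OF chi_c_pos] by (simp add: tau_c_eq)

text \<open>The numerator of \<open>F3\<close> vanishes at \<open>chi_c\<close>, so only its
  derivative counts. There \<open>r3\<close>, \<open>Q\<close> and \<open>Q' = 2 * r0 * r3\<close>
  all vanish as well, leaving \<open>4 * (r0 chi_c)^2 * r4 chi_c\<close>.\<close>

lemma dm_K_4_critical: "dm_K 4 sigma_c j_c = 6 / (pi ^ 4 * chi_c * sqrt (r0 chi_c))"
proof -
  define S where "S = sqrt (r0 chi_c)"
  have S: "0 < S" "r0 chi_c = S\<^sup>2" using r0_pos[OF chi_c_pos] by (auto simp: S_def)
  note D = DERIV_r[OF chi_c_pos] DERIV_Q[OF chi_c_pos] DERIV_sqrt_r0[OF chi_c_pos]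
  have "((\<lambda>x. 4 * (r0 x)^2 * r3 x - 3 * Q x * r1 x) has_real_derivative 4 * (r0 chi_c)^2 * r4 chi_c) (at chi_c)"
    by (auto intro!: derivative_eq_intros D simp: r_chi_c Q_chi_c)
  moreover have "((\<lambda>x. 16 * sqrt (r0 x) ^ 5) has_real_derivative 16 * (5 * S ^ 4 * (r1 chi_c / (2 * S)))) (at chi_c)"
    by (intro DERIV_cmult DERIV_cong[OF DERIV_power[OF DERIV_sqrt_r0[OF chi_c_pos], of 5]]) (simp add: S_def)
  ultimately have "(F3 has_real_derivative
      (4 * (r0 chi_c)^2 * r4 chi_c * (16 * S ^ 5)) / (16 * S ^ 5 * (16 * S ^ 5))) (at chi_c)"
    unfolding F3_def by (rule DERIV_quotient[THEN DERIV_cong]) (use S in \<open>auto simp: r_chi_c Q_chi_c S_def\<close>)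
  also have "(4 * (r0 chi_c)^2 * r4 chi_c * (16 * S ^ 5)) / (16 * S ^ 5 * (16 * S ^ 5)) = 6 / (chi_c * S)"
    unfolding S(2) r_chi_c(5) using S(1) chi_c_pos by (simp add: divide_simps) algebra
  finally have "dm_K (Suc 3) sigma_c j_c = 6 / (chi_c * S) / pi ^ Suc 3"
    using sigma_c_pos by (intro dm_K_Suc[of 3 F3] dm_K_3) (auto simp: sigma_c_div_pi)
  then show ?thesis by (simp add: S_def mult_ac)
qed

lemma a4_K_eq: "a4_K = 1 / (pi^3 * chi_c * B_c)"
  unfolding a4_K_def dm_K_4_critical tau_c_eq
  using chi_c_pos B_c_pos r0_pos[OF chi_c_pos] by (simp add: divide_simps) algebra

lemma deriv_I_K:
  assumes "0 < \<sigma>"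
  shows "(deriv ^^ 1) (\<lambda>s. I_K s tau_c j_c) \<sigma> = dm_K 1 \<sigma> j_c / tau_c - 1"
    and "(deriv ^^ 2) (\<lambda>s. I_K s tau_c j_c) \<sigma> = dm_K 2 \<sigma> j_c / tau_c"
    and "(deriv ^^ 3) (\<lambda>s. I_K s tau_c j_c) \<sigma> = dm_K 3 \<sigma> j_c / tau_c"
proof -
  have 1: "(deriv ^^ Suc 0) (\<lambda>s. I_K s tau_c j_c) \<sigma> = dm_K 1 \<sigma> j_c / tau_c - 1" if "0 < \<sigma>" for \<sigma>
    using that unfolding I_K_def
    by (intro deriv_funpow_Suc_eq[of "{0<..}"]) (use tau_c_pos in \<open>auto intro!: derivative_eq_intros DERIV_dm_K\<close>)
  have 2: "(deriv ^^ Suc (Suc 0)) (\<lambda>s. I_K s tau_c j_c) \<sigma> = dm_K 2 \<sigma> j_c / tau_c" if "0 < \<sigma>" for \<sigma>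
    by (rule deriv_funpow_Suc_eq[of "{0<..}", OF _ _ 1])
       (use that tau_c_pos in \<open>auto intro!: derivative_eq_intros DERIV_dm_K[unfolded One_nat_def]\<close>)
  have 3: "(deriv ^^ Suc (Suc (Suc 0))) (\<lambda>s. I_K s tau_c j_c) \<sigma> = dm_K 3 \<sigma> j_c / tau_c" if "0 < \<sigma>" for \<sigma>
    by (rule deriv_funpow_Suc_eq[of "{0<..}", OF _ _ 2])
       (use that tau_c_pos in \<open>auto intro!: derivative_eq_intros DERIV_dm_K[unfolded One_nat_def]\<close>)
  show "(deriv ^^ 1) (\<lambda>s. I_K s tau_c j_c) \<sigma> = dm_K 1 \<sigma> j_c / tau_c - 1"
    "(deriv ^^ 2) (\<lambda>s. I_K s tau_c j_c) \<sigma> = dm_K 2 \<sigma> j_c / tau_c"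
    "(deriv ^^ 3) (\<lambda>s. I_K s tau_c j_c) \<sigma> = dm_K 3 \<sigma> j_c / tau_c"
    using 1[OF assms] 2[OF assms] 3[OF assms] by (simp_all only: One_nat_def numeral_2_eq_2 numeral_3_eq_3)
qed

lemma dm_K_1_eq_0_iff: "dm_K 1 (pi * x) j_c = 0 \<longleftrightarrow> r1 x = 0" if "0 < x"
  using that r0_pos[OF that] by (simp add: dm_K_1[unfolded One_nat_def] F1_def)

lemma extremal_conj_iff: "(0 < x \<and> dm_K 1 (pi * x) j_c = 0) \<longleftrightarrow> (0 < x \<and> r1 x = 0)"
  using dm_K_1_eq_0_iff by blast

lemma chi_e_pos: "0 < chi_e" and chi_e_root: "r1 chi_e = 0"
  using theI'[OF ex1_extremal] unfolding chi_e_def extremal_conj_iff by auto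

lemma chi_e_less: "chi_e < chi_c"
  using r1_strict_mono[of chi_c chi_e] chi_c_pos chi_e_root r_chi_c(2) B_c_pos
  by (cases chi_c chi_e rule: linorder_cases) auto

lemma dm_K_1_mono: "dm_K 1 s j_c \<le> dm_K 1 t j_c" if "0 < s" "s \<le> t"
proof (rule DERIV_nonneg_imp_nondecreasing[OF that(2)])
  fix \<sigma> assume "s \<le> \<sigma>" "\<sigma> \<le> t"
  then have "0 < \<sigma>" using that by simp
  moreover have "0 \<le> dm_K 2 \<sigma> j_c"
    using \<open>0 < \<sigma>\<close> Q_nonneg[of "\<sigma> / pi"] r0_pos[of "\<sigma> / pi"] by (simp add: dm_K_2 F2_def)
  ultimately show "\<exists>y. ((\<lambda>s. dm_K 1 s j_c) has_real_derivative y) (at \<sigma>) \<and> 0 \<le> y"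
    using DERIV_dm_K(2) by blast
qed

text \<open>Since \<open>4 * m^2 = R\<close> and \<open>x * R\<close> is a polynomial of degree 4, the
  vanishing of the action to fourth order at the critical point is the exact identity
  \<open>R x - (4 * chi_c + 2) * (t + 2 * R chi_c / B_c)^2 = t^4 / x\<close> with \<open>t = x - chi_c\<close>.\<close>

lemma r0_factor:
  assumes "0 < x"
  shows "r0 x - ((4*chi_c + 2) * (x - chi_c)^2 + B_c * (x - chi_c) + r0 chi_c) = (x - chi_c)^4 / x"
  unfolding r_chi_c(1) unfolding r0_def B_c_def using assms by (simp add: divide_simps) algebra

text \<open>The constant that makes \<open>s + k_c\<close> the tangent of the mass over
  \<open>tau_c\<close> at the critical point; it is also the shift in the completed square.\<close>

definition k_c :: real where "k_c = m_K sigma_c j_c / tau_c"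

lemma k_c_eq: "k_c = 2 * pi * r0 chi_c / B_c"
  using r0_pos[OF chi_c_pos] B_c_pos
  by (simp add: k_c_def m_K_eq sigma_c_div_pi tau_c_eq field_simps)

text \<open>Keeps \<open>s + k_c\<close> positive for all \<open>s > - sigma_c\<close>, hence also
  the conjugate factor by which the difference of squares is divided.\<close>

lemma k_c_greater: "sigma_c < k_c"
proof -
  have "chi_c * B_c < 2 * r0 chi_c"
    using chi_c_pos by (simp add: r_chi_c B_c_def algebra_simps eval_nat_numeral add_pos_pos)
  then have "pi * (chi_c * B_c) < pi * (2 * r0 chi_c)" by simp
  then show ?thesis using B_c_pos by (simp add: k_c_eq sigma_c_def field_simps)
qed

text \<open>Matches the squared tangent slope with the leading coefficient of the quadratic part of
  \<open>r0\<close> around \<open>chi_c\<close>.\<close>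

lemma tau_c_sq: "4 * pi\<^sup>2 * tau_c\<^sup>2 = 4 * chi_c + 2"
proof -
  have "4 * pi\<^sup>2 * tau_c\<^sup>2 = B_c\<^sup>2 / (4 * r0 chi_c)"
    using r0_pos[OF chi_c_pos] by (simp add: tau_c_eq power_divide power_mult_distrib)
  also have "\<dots> = 4 * chi_c + 2"
    unfolding B_c_sq using r0_pos[OF chi_c_pos] by (simp add: divide_simps)
  finally show ?thesis .
qed

text \<open>Squaring removes the root: the scaled mass and its tangent line are compared through
  their squares, where the difference is rational.\<close>

lemma critical_square:
  assumes "0 < \<sigma>"
  shows "(m_K \<sigma> j_c / tau_c)\<^sup>2 - (\<sigma> - sigma_c + k_c)\<^sup>2 = (\<sigma> - sigma_c)^4 / (4 * pi^3 * tau_c\<^sup>2 * \<sigma>)"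
proof -
  define t where "t = \<sigma> / pi - chi_c"
  have s: "\<sigma> - sigma_c = pi * t" "\<sigma> / pi - chi_c = t" by (simp_all add: t_def sigma_c_def algebra_simps)
  have T: "4 * tau_c\<^sup>2 \<noteq> 0" using tau_c_pos by simp
  have "4 * tau_c\<^sup>2 * (m_K \<sigma> j_c / tau_c)\<^sup>2 = r0 (\<sigma> / pi)"
    using tau_c_pos r0_pos[of "\<sigma> / pi"] assms by (simp add: m_K_eq power_divide)
  moreover have "4 * tau_c\<^sup>2 * (\<sigma> - sigma_c + k_c)\<^sup>2 = (4 * pi\<^sup>2 * tau_c\<^sup>2) * (t + 2 * r0 chi_c / B_c)\<^sup>2"
    by (simp add: s k_c_eq algebra_simps power2_eq_square)
  moreover have "(4 * pi\<^sup>2 * tau_c\<^sup>2) * (t + 2 * r0 chi_c / B_c)\<^sup>2 = (4*chi_c + 2) * t\<^sup>2 + B_c * t + r0 chi_c"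
  proof -
    \<comment> \<open>\<open>B_c_sq\<close> says that
      \<open>(4*chi_c + 2) * t^2 + B_c * t + r0 chi_c\<close> has discriminant zero, so it is a
      perfect square up to the factor \<open>4*chi_c + 2\<close>.\<close>
    have "4 * chi_c + 2 = B_c\<^sup>2 / (4 * r0 chi_c)"
      using B_c_sq r0_pos[OF chi_c_pos] by (simp add: field_simps)
    then have "(4 * chi_c + 2) * (4 * r0 chi_c / B_c) = B_c" "(4 * chi_c + 2) * (2 * r0 chi_c / B_c)\<^sup>2 = r0 chi_c"
      using B_c_pos r0_pos[OF chi_c_pos] by (simp_all add: power_divide power_mult_distrib) (simp_all add: power2_eq_square)
    moreover have "(4 * chi_c + 2) * (t + 2 * r0 chi_c / B_c)\<^sup>2 = (4*chi_c + 2) * t\<^sup>2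
        + (4 * chi_c + 2) * (4 * r0 chi_c / B_c) * t + (4 * chi_c + 2) * (2 * r0 chi_c / B_c)\<^sup>2"
    proof -
      have "K * (t + u)\<^sup>2 = K * t\<^sup>2 + K * (2 * u) * t + K * u\<^sup>2" for K u by algebra
      from this[of "4 * chi_c + 2" "2 * r0 chi_c / B_c"] show ?thesis by simp
    qed
    ultimately show ?thesis by (simp only: tau_c_sq)
  qed
  ultimately have "4 * tau_c\<^sup>2 * ((m_K \<sigma> j_c / tau_c)\<^sup>2 - (\<sigma> - sigma_c + k_c)\<^sup>2) = t^4 / (\<sigma> / pi)"
    using r0_factor[of "\<sigma> / pi"] assms by (simp only: right_diff_distrib s(2)) simp
  also have "\<dots> = 4 * tau_c\<^sup>2 * ((\<sigma> - sigma_c)^4 / (4 * pi^3 * tau_c\<^sup>2 * \<sigma>))"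
    unfolding s(1) using tau_c_pos assms by (simp add: divide_simps) algebra
  finally show ?thesis by (simp only: mult_left_cancel[OF T])
qed

definition phi :: "real \<Rightarrow> real" where
  "phi s = m_K (sigma_c + s) j_c / tau_c - k_c - s"
definition phi' :: "real \<Rightarrow> real" where
  "phi' s = dm_K 1 (sigma_c + s) j_c / tau_c - 1"
text \<open>The reciprocal of \<open>h\<close>: the conjugate factor of the difference of squares
  times the denominator of the quartic identity. At \<open>s = 0\<close> it equals
  \<open>1 / a4_K\<close>. \<open>D1\<close> and \<open>D2\<close> are its derivatives. As
  \<open>D2\<close> contains no derivative of the mass beyond the second, the smoothness of
  \<open>h\<close> at 0 costs far fewer derivatives than dividing a Taylor expansion by
  \<open>s ^ 4\<close>.\<close>

definition D0 :: "real \<Rightarrow> real" where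
  "D0 s = 4 * pi^3 * tau_c\<^sup>2 * ((sigma_c + s) * (m_K (sigma_c + s) j_c / tau_c + s + k_c))"
definition D1 :: "real \<Rightarrow> real" where
  "D1 s = 4 * pi^3 * tau_c\<^sup>2 * ((m_K (sigma_c + s) j_c / tau_c + s + k_c)
     + (sigma_c + s) * (dm_K 1 (sigma_c + s) j_c / tau_c + 1))"
definition D2 :: "real \<Rightarrow> real" where
  "D2 s = 4 * pi^3 * tau_c\<^sup>2 * (2 * (dm_K 1 (sigma_c + s) j_c / tau_c + 1)
     + (sigma_c + s) * (dm_K 2 (sigma_c + s) j_c / tau_c))"

section \<open>The critical action as a quartic minimum\<close>

lemma DERIV_shift_critical:
  assumes "- sigma_c < s"
  shows "((\<lambda>s. m_K (sigma_c + s) j_c) has_real_derivative dm_K 1 (sigma_c + s) j_c) (at s)"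
    and "((\<lambda>s. dm_K 1 (sigma_c + s) j_c) has_real_derivative dm_K 2 (sigma_c + s) j_c) (at s)"
    and "((\<lambda>s. dm_K 2 (sigma_c + s) j_c) has_real_derivative dm_K 3 (sigma_c + s) j_c) (at s)"
  using DERIV_dm_K[of "sigma_c + s"] assms
  by (simp_all add: DERIV_shift add.commute[of sigma_c])

lemma D0_pos: "0 < D0 s" if "- sigma_c < s"
proof -
  have "0 < sigma_c + s" "0 < s + k_c" using that k_c_greater by auto
  moreover have "0 \<le> m_K (sigma_c + s) j_c / tau_c"
    using r0_pos[of "(sigma_c + s) / pi"] tau_c_pos \<open>0 < sigma_c + s\<close> by (simp add: m_K_eq)
  ultimately show ?thesis using tau_c_pos by (simp add: D0_def add_nonneg_pos add.assoc)
qed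

lemma phi_eq: "phi s = s ^ 4 * (1 / D0 s)" if "- sigma_c < s"
proof -
  define y where "y = m_K (sigma_c + s) j_c / tau_c"
  define A where "A = 4 * pi^3 * tau_c\<^sup>2 * (sigma_c + s)"
  have A: "0 < A" using that tau_c_pos by (simp add: A_def)
  have D: "D0 s = A * (y + s + k_c)" by (simp add: D0_def A_def y_def mult.assoc)
  have "y\<^sup>2 - (s + k_c)\<^sup>2 = s ^ 4 / A"
    using critical_square[of "sigma_c + s"] that by (simp add: y_def A_def)
  moreover have "y\<^sup>2 - (s + k_c)\<^sup>2 = phi s * (y + s + k_c)"
    unfolding phi_def y_def[symmetric] by algebra
  ultimately have "phi s * D0 s = s ^ 4"
    unfolding D using A by (simp add: field_simps)
  then show ?thesis using D0_pos[OF that] by (simp add: field_simps)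
qed

text \<open>The point \<open>- d\<close> is the extremal horizon, where the vanishing temperature
  gives \<open>phi' = - 1\<close>, the equality case of \<open>f'_ge\<close>; \<open>- e\<close>
  corresponds to \<sigma> = 0.\<close>

interpretation critical: quartic_minimum phi phi' "\<lambda>s. 1 / D0 s" "\<lambda>s. - D1 s / (D0 s)\<^sup>2"
  "\<lambda>s. - D2 s / (D0 s)\<^sup>2 + 2 * (D1 s)\<^sup>2 / (D0 s) ^ 3" "sigma_c - pi * chi_e" sigma_c
proof
  show "0 < sigma_c - pi * chi_e" using chi_e_less by (simp add: sigma_c_def)
  show "sigma_c - pi * chi_e < sigma_c" using chi_e_pos by simp
  have "dm_K 1 (pi * chi_e) j_c = 0"
    using dm_K_1_eq_0_iff[OF chi_e_pos] chi_e_root by blast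
  then show "- 1 \<le> phi' (- (sigma_c - pi * chi_e))" by (simp add: phi'_def)
  fix s assume s: "- sigma_c < s"
  note D = DERIV_shift_critical[OF s] and pos = D0_pos[OF s] tau_c_pos
  show "(phi has_real_derivative phi' s) (at s)"
    unfolding phi_def phi'_def using pos by (auto intro!: derivative_eq_intros D)
  show "phi' s \<le> phi' t" if "s \<le> t" for t
    unfolding phi'_def using dm_K_1_mono[of "sigma_c + s" "sigma_c + t"] s that pos
    by (simp add: divide_right_mono)
  show "phi s = s ^ 4 * (1 / D0 s)" by (rule phi_eq[OF s])
  show "0 < 1 / D0 s" using pos by simp
  note Y = D(1,2)[THEN DERIV_cdivide, of tau_c]
  have D0: "(D0 has_real_derivative D1 s) (at s)"
    unfolding D0_def D1_def using pos
    by (intro DERIV_cong[OF DERIV_cmult[OF DERIV_mult[OF DERIV_add[OF DERIV_const DERIV_ident]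
        DERIV_add[OF DERIV_add[OF Y(1) DERIV_ident] DERIV_const]]]]) (simp add: mult.commute)
  have D1: "(D1 has_real_derivative D2 s) (at s)"
    unfolding D1_def D2_def using pos
    by (intro DERIV_cong[OF DERIV_cmult[OF DERIV_add[OF DERIV_add[OF DERIV_add[OF Y(1) DERIV_ident] DERIV_const]
        DERIV_mult[OF DERIV_add[OF DERIV_const DERIV_ident] DERIV_add[OF Y(2) DERIV_const]]]]])
       (simp add: algebra_simps)
  show "((\<lambda>s. 1 / D0 s) has_real_derivative - D1 s / (D0 s)\<^sup>2) (at s)"
    using pos by (auto intro!: derivative_eq_intros D0 simp: power2_eq_square)
  show "((\<lambda>s. - D1 s / (D0 s)\<^sup>2) has_real_derivative - D2 s / (D0 s)\<^sup>2 + 2 * (D1 s)\<^sup>2 / (D0 s) ^ 3) (at s)"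
  proof (rule DERIV_cong[OF DERIV_divide[OF DERIV_minus[OF D1] DERIV_power[OF D0, of 2]]])
    show "(D0 s)\<^sup>2 \<noteq> 0" using pos by simp
    show "(- D2 s * (D0 s)\<^sup>2 - - D1 s * (of_nat 2 * (D1 s * D0 s ^ (2 - Suc 0)))) / ((D0 s)\<^sup>2 * (D0 s)\<^sup>2)
      = - D2 s / (D0 s)\<^sup>2 + 2 * (D1 s)\<^sup>2 / (D0 s) ^ 3"
      using pos by (simp add: divide_simps) algebra
  qed
  \<comment> \<open>Continuity of the second derivative of the mass is read off from the existence
    of the third.\<close>
  have "isCont D2 s" unfolding D2_def
    using D(2,3)[THEN DERIV_isCont] pos by (intro continuous_intros) auto
  then show "isCont (\<lambda>s. - D2 s / (D0 s)\<^sup>2 + 2 * (D1 s)\<^sup>2 / (D0 s) ^ 3) s"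
    using D0[THEN DERIV_isCont] D1[THEN DERIV_isCont] pos by (intro continuous_intros) auto
qed

section \<open>Translation to the physical ensemble\<close>

lemma set_integrable_shift:
  fixes p :: "real \<Rightarrow> real"
  shows "set_integrable lborel {a<..} p \<longleftrightarrow> set_integrable lborel {a - t<..} (\<lambda>s. p (t + s))"
    and "(LINT s:{a<..}|lborel. p s) = (LINT s:{a - t<..}|lborel. p (t + s))"
proof -
  have *: "indicator {a<..} (t + s) = (indicator {a - t<..} s :: real)" for s
    by (auto split: split_indicator)
  show "set_integrable lborel {a<..} p \<longleftrightarrow> set_integrable lborel {a - t<..} (\<lambda>s. p (t + s))"
    using lborel_integrable_real_affine_iff[of 1 "\<lambda>s. indicator {a<..} s *\<^sub>R p s" t]
    by (simp add: set_integrable_def *)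
  show "(LINT s:{a<..}|lborel. p s) = (LINT s:{a - t<..}|lborel. p (t + s))"
    using lborel_integral_real_affine[of 1 "\<lambda>s. indicator {a<..} s *\<^sub>R p s" t]
    by (simp add: set_lebesgue_integral_def *)
qed

lemma I_K_critical: "I_K (sigma_c + s) tau_c j_c = phi s + I_K sigma_c tau_c j_c"
  by (simp add: I_K_def phi_def k_c_def)

text \<open>The prefactor does not depend on \<open>s\<close>, so it cancels in the normalized
  average.\<close>

lemma weight_shift:
  assumes "0 < g" "0 < L"
  shows "weight g L (sigma_c + s) = tau_c * exp (- (I_K sigma_c tau_c j_c / g)) * critical.W g s"
proof -
  have "dm_K 1 (sigma_c + s) j_c = tau_c * (1 + phi' s)"
    using tau_c_pos by (simp add: phi'_def)
  moreover have "exp (- I_E g L (sigma_c + s) tau_c j_c)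
      = exp (- (I_K sigma_c tau_c j_c / g)) * critical.boltzmann g s"
    using assms tau_c_pos
    by (simp add: I_E_eq I_K_critical critical.boltzmann_def add_divide_distrib flip: exp_add)
  ultimately show ?thesis by (simp add: weight_def critical.W_def)
qed

lemma F_gen_shift:
  assumes "0 < g" "0 < L"
  shows "F_gen g L (sigma_c + s) tau_c j_c = T_c L * (phi s / g) + F_Kc g L"
proof -
  have "T_c L \<noteq> 0" using assms tau_c_pos by (simp add: T_c_def T_phys_def)
  then have "F_gen g L (sigma_c + s) tau_c j_c = T_c L * I_E g L (sigma_c + s) tau_c j_c"
    by (simp add: I_E_def T_c_def)
  then show ?thesis
    using assms tau_c_pos by (simp add: I_E_eq I_K_critical F_Kc_def add_divide_distrib distrib_left)
qed

lemma critical_ensemble: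
  assumes "0 < g" "0 < L"
  defines "A \<equiv> tau_c * exp (- (I_K sigma_c tau_c j_c / g))"
  shows "set_integrable lborel {pi * chi_e<..} (weight g L)"
    and "(LINT \<sigma>:{pi * chi_e<..}|lborel. weight g L \<sigma>) = A * critical.Z g"
    and "set_integrable lborel {pi * chi_e<..} (\<lambda>\<sigma>. F_gen g L \<sigma> tau_c j_c * weight g L \<sigma>)"
    and "(LINT \<sigma>:{pi * chi_e<..}|lborel. F_gen g L \<sigma> tau_c j_c * weight g L \<sigma>)
      = A * (T_c L * critical.N g + F_Kc g L * critical.Z g)"
proof -
  have a: "pi * chi_e - sigma_c = - (sigma_c - pi * chi_e)" by simp
  note shift = set_integrable_shift[of "pi * chi_e" _ sigma_c, unfolded a]
  have W: "weight g L (sigma_c + s) = A * critical.W g s" for s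
    using weight_shift[OF assms(1,2)] by (simp add: A_def)
  have FW: "F_gen g L (sigma_c + s) tau_c j_c * weight g L (sigma_c + s)
      = A * T_c L * (phi s / g * critical.W g s) + A * F_Kc g L * critical.W g s" for s
    by (simp only: F_gen_shift[OF assms(1,2)] W) (simp add: algebra_simps)
  note I = critical.set_integrable_W[OF assms(1)]
  note I' = I(2)[THEN set_integrable_mult_right, of "A * T_c L"] I(1)[THEN set_integrable_mult_right, of "A * F_Kc g L"]
  show "set_integrable lborel {pi * chi_e<..} (weight g L)"
    unfolding shift(1) W using I(1) by (intro set_integrable_mult_right)
  show "(LINT \<sigma>:{pi * chi_e<..}|lborel. weight g L \<sigma>) = A * critical.Z g"
    unfolding shift(2) W critical.Z_def by simp
  show "set_integrable lborel {pi * chi_e<..} (\<lambda>\<sigma>. F_gen g L \<sigma> tau_c j_c * weight g L \<sigma>)"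
    unfolding shift(1) FW using I' by (intro set_integral_add)
  have "(LINT \<sigma>:{pi * chi_e<..}|lborel. F_gen g L \<sigma> tau_c j_c * weight g L \<sigma>)
      = A * T_c L * critical.N g + A * F_Kc g L * critical.Z g"
    unfolding shift(2) FW critical.Z_def critical.N_def set_integral_add(2)[OF I'] by (simp only: set_integral_mult_right)
  then show "(LINT \<sigma>:{pi * chi_e<..}|lborel. F_gen g L \<sigma> tau_c j_c * weight g L \<sigma>)
      = A * (T_c L * critical.N g + F_Kc g L * critical.Z g)"
    by (simp add: algebra_simps)
qed

text \<open>The classical value separates exactly, so the whole correction is the mean of
  \<open>phi / g\<close>, with no dependence on \<open>L\<close> left.\<close>

lemma F_bar_eq:
  assumes "0 < g" "0 < L"
  shows "(F_bar g L - F_Kc g L) / T_c L = critical.N g / critical.Z g"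
proof -
  have "T_c L \<noteq> 0" using assms tau_c_pos by (simp add: T_c_def T_phys_def)
  moreover have "critical.Z g \<noteq> 0" using critical.Z_pos[OF assms(1)] by simp
  ultimately show ?thesis
    using tau_c_pos unfolding F_bar_def critical_ensemble(2,4)[OF assms] by (simp add: field_simps)
qed

theorem mainTheorem7:
  fixes L :: real
  assumes "L > 0"
  shows
    "((\<exists>!x::real. x > 0 \<and> 8*x^3 + 10*x^2 + 2*x - 1 = 0) \<and>
      chi_c > 0 \<and> 8*chi_c^3 + 10*chi_c^2 + 2*chi_c - 1 = 0 \<and>
      dm_K 2 sigma_c j_c = 0 \<and> dm_K 3 sigma_c j_c = 0 \<and>
      tau_c = B_c / (4 * pi * sqrt (R_K chi_c j_c)))
     \<and>
     ((\<forall>k\<in>{1,2,3}. (deriv ^^ k) (\<lambda>\<sigma>. I_K \<sigma> tau_c j_c) sigma_c = 0) \<and>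
      a4_K = 1 / (pi^3 * chi_c * B_c) \<and> a4_K > 0)
     \<and>
     ((\<exists>!x. x > 0 \<and> dm_K 1 (pi*x) j_c = 0) \<and>
      (\<forall>x>0. dm_K 1 (pi*x) j_c = 0 \<longleftrightarrow> 3*x^4 + 4*x^3 + x^2 - chi_c^4 = 0) \<and>
      0 < chi_e \<and> dm_K 1 (pi*chi_e) j_c = 0 \<and> chi_e < chi_c)
     \<and>
     (dm_K 1 sigma_c j_c = tau_c \<and> tau_c > 0 \<and>
      (\<forall>g>0. set_integrable lborel {pi*chi_e<..} (\<lambda>\<sigma>. weight g L \<sigma>) \<and>
             set_integrable lborel {pi*chi_e<..} (\<lambda>\<sigma>. F_gen g L \<sigma> tau_c j_c * weight g L \<sigma>) \<and>
             (LINT \<sigma>:{pi*chi_e<..}|lborel. weight g L \<sigma>) > 0) \<and>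
      (\<lambda>g. (F_bar g L - F_Kc g L) / T_c L - 1/4) \<in> O[at_right 0](\<lambda>g. g powr (1/2)))"
proof (intro conjI)
  show "\<exists>!x::real. x > 0 \<and> 8*x^3 + 10*x^2 + 2*x - 1 = 0" by (rule ex1_critical_cubic)
  show "tau_c = B_c / (4 * pi * sqrt (R_K chi_c j_c))" by (simp add: tau_c_eq R_K_j_c)
  show tau: "dm_K 1 sigma_c j_c = tau_c" by (simp add: tau_c_def)
  show "\<forall>k\<in>{1,2,3}. (deriv ^^ k) (\<lambda>\<sigma>. I_K \<sigma> tau_c j_c) sigma_c = 0"
    using deriv_I_K[OF sigma_c_pos] dm_K_critical tau tau_c_pos by simp
  show "a4_K > 0" using chi_c_pos B_c_pos by (simp add: a4_K_eq)
  show "\<exists>!x. x > 0 \<and> dm_K 1 (pi*x) j_c = 0"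
    unfolding extremal_conj_iff by (rule ex1_extremal)
  show "\<forall>x>0. dm_K 1 (pi*x) j_c = 0 \<longleftrightarrow> 3*x^4 + 4*x^3 + x^2 - chi_c^4 = 0"
    using dm_K_1_eq_0_iff r1_eq_0_iff by blast
  show "dm_K 1 (pi*chi_e) j_c = 0" using dm_K_1_eq_0_iff[OF chi_e_pos] chi_e_root by blast
  show "\<forall>g>0. set_integrable lborel {pi*chi_e<..} (\<lambda>\<sigma>. weight g L \<sigma>) \<and>
             set_integrable lborel {pi*chi_e<..} (\<lambda>\<sigma>. F_gen g L \<sigma> tau_c j_c * weight g L \<sigma>) \<and>
             (LINT \<sigma>:{pi*chi_e<..}|lborel. weight g L \<sigma>) > 0"
    using critical_ensemble[OF _ assms] critical.Z_pos tau_c_pos by simp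
  have "eventually (\<lambda>g. critical.N g / critical.Z g - 1/4 = (F_bar g L - F_Kc g L) / T_c L - 1/4) (at_right 0)"
    using assms by (auto simp: F_bar_eq eventually_at_right_field intro!: exI[of _ 1])
  then show "(\<lambda>g. (F_bar g L - F_Kc g L) / T_c L - 1/4) \<in> O[at_right 0](\<lambda>g. g powr (1/2))"
    using critical.mean_quarter by (subst (asm) landau_o.big.in_cong)
qed (use chi_c_pos chi_c_root dm_K_critical a4_K_eq chi_e_pos chi_e_less tau_c_pos in auto)

end
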